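(* Given a connected $(P_4+P_1)$-free graph $G$ with $n$ vertices and $m$ edges, one can decide whether $\operatorname{diam}(G)=4$ in $O(n+m)$ time. (Here $4=d_{\max}$, the maximum diameter of a connected $(P_4+P_1)$-free graph.)
   Context: Graphs are finite, simple, undirected and unweighted. A graph is $H$-free if it does not contain $H$ as an induced subgraph; $P_4+P_1$ is the disjoint union of a path on four vertices and an isolated vertex. $\operatorname{diam}(G)=\max_{u,v}d(u,v)$ with $d$ the shortest-path distance; $d_{\max}$ of a class is the supremum of the diameters of its graphs. *)

theory Defs
  imports Main "HOL-Library.Extended_Nat"
begin

section \<open>Graphs\<close>

record 'a graph =
  verts :: "'a set"
  edges :: "'a set set"

definition simple_graph :: "'a graph \<Rightarrow> bool" where
  "simple_graph G \<longleftrightarrow> finite (verts G) \<and> (\<forall>e \<in> edges G. e \<subseteq> verts G \<and> card e = 2)"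

definition induced_subgraph :: "'a graph \<Rightarrow> 'a set \<Rightarrow> 'a graph" where
  "induced_subgraph G S = \<lparr>verts = S, edges = {e \<in> edges G. e \<subseteq> S}\<rparr>"

definition graph_iso :: "'a graph \<Rightarrow> 'b graph \<Rightarrow> bool" where
  "graph_iso G H \<longleftrightarrow> (\<exists>f. bij_betw f (verts G) (verts H) \<and>
     (\<forall>u \<in> verts G. \<forall>v \<in> verts G. {u, v} \<in> edges G \<longleftrightarrow> {f u, f v} \<in> edges H))"

definition free_of :: "'b graph \<Rightarrow> 'a graph \<Rightarrow> bool" where
  "free_of H G \<longleftrightarrow> \<not> (\<exists>S \<subseteq> verts G. graph_iso H (induced_subgraph G S))"

definition path_graph :: "nat \<Rightarrow> nat graph" where
  "path_graph n = \<lparr>verts = {..<n}, edges = {{i, Suc i} | i. Suc i < n}\<rparr>"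

definition disjoint_union :: "'a graph \<Rightarrow> 'b graph \<Rightarrow> ('a + 'b) graph" where
  "disjoint_union G H =
     \<lparr>verts = verts G <+> verts H,
      edges = (\<lambda>e. Inl ` e) ` edges G \<union> (\<lambda>e. Inr ` e) ` edges H\<rparr>"

definition P4_plus_P1 :: "(nat + nat) graph" where
  "P4_plus_P1 = disjoint_union (path_graph 4) (path_graph 1)"

definition path_between :: "'a graph \<Rightarrow> 'a \<Rightarrow> 'a list \<Rightarrow> 'a \<Rightarrow> bool" where
  "path_between G u p v \<longleftrightarrow>
     p \<noteq> [] \<and> hd p = u \<and> last p = v \<and> distinct p \<and> set p \<subseteq> verts G \<and>
     (\<forall>i. Suc i < length p \<longrightarrow> {p ! i, p ! Suc i} \<in> edges G)"

definition connected_graph :: "'a graph \<Rightarrow> bool" where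
  "connected_graph G \<longleftrightarrow>
     verts G \<noteq> {} \<and> (\<forall>u \<in> verts G. \<forall>v \<in> verts G. \<exists>p. path_between G u p v)"

text \<open>The length of a path is its number of edges; the infimum over no paths is \<open>\<infinity>\<close>.\<close>

definition graph_dist :: "'a graph \<Rightarrow> 'a \<Rightarrow> 'a \<Rightarrow> enat" where
  "graph_dist G u v = Inf {enat (length p - 1) | p. path_between G u p v}"

definition diam :: "'a graph \<Rightarrow> enat" where
  "diam G = Max {graph_dist G u v | u v. u \<in> verts G \<and> v \<in> verts G}"

definition d_max :: "'a graph set \<Rightarrow> enat" where
  "d_max \<C> = (SUP G \<in> \<C>. diam G)"


section \<open>Random access machine\<close>

text \<open>
  Running time is measured on a unit-cost word RAM in structured form: a program uses
  finitely many registers and finitely many arrays with constant-time indexed access, and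
  elementary operations are addition, truncated subtraction and comparison. The parameter
  \<open>B\<close> of the semantics models the word size: execution gets stuck as soon as a
  computed value or address does not lie below \<open>B\<close>.
\<close>

record state =
  reg :: "nat \<Rightarrow> nat"
  arr :: "nat \<Rightarrow> nat \<Rightarrow> nat"

datatype aexp = Const nat | Reg nat | Read nat aexp | Plus aexp aexp | Minus aexp aexp

datatype bexp = Less aexp aexp | Equal aexp aexp | Neg bexp | Conj bexp bexp

datatype com =
    Skip
  | SetReg nat aexp
  | Write nat aexp aexp \<comment> \<open>array name, index, value\<close>
  | Seq com com
  | If bexp com com
  | While bexp com

fun aval :: "state \<Rightarrow> aexp \<Rightarrow> nat" where
  "aval s (Const n) = n"
| "aval s (Reg r) = reg s r"
| "aval s (Read a e) = arr s a (aval s e)"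
| "aval s (Plus e f) = aval s e + aval s f"
| "aval s (Minus e f) = aval s e - aval s f"

fun afits :: "nat \<Rightarrow> state \<Rightarrow> aexp \<Rightarrow> bool" where
  "afits B s (Const n) \<longleftrightarrow> n < B"
| "afits B s (Reg r) \<longleftrightarrow> reg s r < B"
| "afits B s (Read a e) \<longleftrightarrow> afits B s e \<and> arr s a (aval s e) < B"
| "afits B s (Plus e f) \<longleftrightarrow> afits B s e \<and> afits B s f \<and> aval s e + aval s f < B"
| "afits B s (Minus e f) \<longleftrightarrow> afits B s e \<and> afits B s f"

fun acost :: "aexp \<Rightarrow> nat" where
  "acost (Const n) = 1"
| "acost (Reg r) = 1"
| "acost (Read a e) = acost e + 1"
| "acost (Plus e f) = acost e + acost f + 1"
| "acost (Minus e f) = acost e + acost f + 1"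

fun bval :: "state \<Rightarrow> bexp \<Rightarrow> bool" where
  "bval s (Less e f) \<longleftrightarrow> aval s e < aval s f"
| "bval s (Equal e f) \<longleftrightarrow> aval s e = aval s f"
| "bval s (Neg b) \<longleftrightarrow> \<not> bval s b"
| "bval s (Conj b c) \<longleftrightarrow> bval s b \<and> bval s c"

fun bfits :: "nat \<Rightarrow> state \<Rightarrow> bexp \<Rightarrow> bool" where
  "bfits B s (Less e f) \<longleftrightarrow> afits B s e \<and> afits B s f"
| "bfits B s (Equal e f) \<longleftrightarrow> afits B s e \<and> afits B s f"
| "bfits B s (Neg b) \<longleftrightarrow> bfits B s b"
| "bfits B s (Conj b c) \<longleftrightarrow> bfits B s b \<and> bfits B s c"

fun bcost :: "bexp \<Rightarrow> nat" where
  "bcost (Less e f) = acost e + acost f + 1"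
| "bcost (Equal e f) = acost e + acost f + 1"
| "bcost (Neg b) = bcost b + 1"
| "bcost (Conj b c) = bcost b + bcost c + 1"

definition set_reg :: "nat \<Rightarrow> nat \<Rightarrow> state \<Rightarrow> state" where
  "set_reg r x s = s\<lparr>reg := (reg s)(r := x)\<rparr>"

definition set_arr :: "nat \<Rightarrow> nat \<Rightarrow> nat \<Rightarrow> state \<Rightarrow> state" where
  "set_arr a i x s = s\<lparr>arr := (arr s)(a := (arr s a)(i := x))\<rparr>"

text \<open>\<open>exec B c s t s'\<close>: started in \<open>s\<close>, program \<open>c\<close> halts in
  \<open>s'\<close> after exactly \<open>t\<close> steps.\<close>

inductive exec :: "nat \<Rightarrow> com \<Rightarrow> state \<Rightarrow> nat \<Rightarrow> state \<Rightarrow> bool" for B where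
  Skip: "exec B Skip s 1 s"
| SetReg: "afits B s e \<Longrightarrow>
    exec B (SetReg r e) s (acost e + 1) (set_reg r (aval s e) s)"
| Write: "afits B s e \<Longrightarrow> afits B s f \<Longrightarrow>
    exec B (Write a e f) s (acost e + acost f + 1) (set_arr a (aval s e) (aval s f) s)"
| Seq: "exec B c s t s' \<Longrightarrow> exec B d s' u s'' \<Longrightarrow> exec B (Seq c d) s (t + u) s''"
| IfTrue: "bfits B s b \<Longrightarrow> bval s b \<Longrightarrow> exec B c s t s' \<Longrightarrow>
    exec B (If b c d) s (bcost b + t + 1) s'"
| IfFalse: "bfits B s b \<Longrightarrow> \<not> bval s b \<Longrightarrow> exec B d s t s' \<Longrightarrow>
    exec B (If b c d) s (bcost b + t + 1) s'"
| WhileFalse: "bfits B s b \<Longrightarrow> \<not> bval s b \<Longrightarrow>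
    exec B (While b c) s (bcost b + 1) s"
| WhileTrue: "bfits B s b \<Longrightarrow> bval s b \<Longrightarrow> exec B c s t s' \<Longrightarrow>
    exec B (While b c) s' u s'' \<Longrightarrow> exec B (While b c) s (bcost b + t + u + 1) s''"

inductive_cases execE:
  "exec B Skip s t s'"
  "exec B (SetReg r e) s t s'"
  "exec B (Write a e f) s t s'"
  "exec B (Seq c d) s t s'"
  "exec B (If b c d) s t s'"
  "exec B (While b c) s t s'"

lemma exec_deterministic:
  "exec B c s t s' \<Longrightarrow> exec B c s u s'' \<Longrightarrow> u = t \<and> s'' = s'"
proof (induction arbitrary: u s'' rule: exec.induct)
  case (Skip s)
  from Skip.prems show ?case by (rule execE(1)) simp
next
  case (SetReg s e r)
  from SetReg.prems show ?case by (rule execE(2)) simp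
next
  case (Write s e f a)
  from Write.prems show ?case by (rule execE(3)) simp
next
  case (Seq c s t s' d v r)
  from Seq.prems obtain t1 s1 t2 where
    1: "exec B c s t1 s1" "exec B d s1 t2 s''" "u = t1 + t2" by (rule execE(4))
  from Seq.IH(1)[OF 1(1)] Seq.IH(2) 1 show ?case by simp
next
  case (IfTrue s b c t s' d)
  from IfTrue.prems obtain t1 where
    "exec B c s t1 s''" "u = bcost b + t1 + 1" by (rule execE(5)) (use IfTrue.hyps in auto)
  with IfTrue.IH show ?case by simp
next
  case (IfFalse s b d t s' c)
  from IfFalse.prems obtain t1 where
    "exec B d s t1 s''" "u = bcost b + t1 + 1" by (rule execE(5)) (use IfFalse.hyps in auto)
  with IfFalse.IH show ?case by simp
next
  case (WhileFalse s b c)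
  from WhileFalse.prems show ?case by (rule execE(6)) (use WhileFalse.hyps in simp_all)
next
  case (WhileTrue s b c t s' v r)
  from WhileTrue.prems obtain t1 s1 t2 where
    1: "exec B c s t1 s1" "exec B (While b c) s1 t2 s''" "u = bcost b + t1 + t2 + 1"
    by (rule execE(6)) (use WhileTrue.hyps in auto)
  from WhileTrue.IH(1)[OF 1(1)] WhileTrue.IH(2) 1 show ?case by simp
qed


section \<open>Input format\<close>

text \<open>The vertices are numbered by the list \<open>vs\<close>; entry \<open>i\<close> of \<open>adj\<close> lists
  the numbers of the neighbours of vertex number \<open>i\<close>, in any order.\<close>

definition adjacency_lists :: "'a graph \<Rightarrow> 'a list \<Rightarrow> nat list list \<Rightarrow> bool" where
  "adjacency_lists G vs adj \<longleftrightarrow>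
     distinct vs \<and> set vs = verts G \<and> length adj = length vs \<and>
     (\<forall>i < length vs. distinct (adj ! i) \<and>
        set (adj ! i) = {j. j < length vs \<and> {vs ! i, vs ! j} \<in> edges G})"

text \<open>Register 0 holds the number of vertices, array 1 the concatenation of the adjacency
  lists, and array 0 the start positions of the individual lists in array 1 (followed by the
  total length). All other cells are 0.\<close>

definition input_state :: "nat list list \<Rightarrow> state" where
  "input_state adj =
     \<lparr>reg = (\<lambda>r. if r = 0 then length adj else 0),
      arr = (\<lambda>a i.
        if a = 0 \<and> i \<le> length adj then length (concat (take i adj))
        else if a = 1 \<and> i < length (concat adj) then concat adj ! i
        else 0)\<rparr>"

text \<open>Words have at most \<open>k * log 2 (n + 1)\<close> bits, where \<open>n\<close> is the number of vertices.
  Correctness and the time bound are only required for graphs in the class \<open>\<C>\<close>.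
  The answer is returned in register 0.\<close>

definition decides_in_time ::
  "com \<Rightarrow> nat \<Rightarrow> nat graph set \<Rightarrow> (nat graph \<Rightarrow> bool) \<Rightarrow> (nat graph \<Rightarrow> nat) \<Rightarrow> bool" where
  "decides_in_time c k \<C> Q T \<longleftrightarrow>
     (\<forall>G \<in> \<C>. \<forall>vs adj. adjacency_lists G vs adj \<longrightarrow>
        (\<exists>t s. exec ((card (verts G) + 1) ^ k) c (input_state adj) t s \<and> t \<le> T G \<and>
               reg s 0 = (if Q G then 1 else 0)))"

text \<open>Every finite graph is isomorphic to one whose vertices are natural numbers.\<close>

definition connected_P4_P1_free :: "nat graph set" where
  "connected_P4_P1_free = {G. simple_graph G \<and> connected_graph G \<and> free_of P4_plus_P1 G}"

end

theory Submission
  imports Defs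
begin

text \<open>
  Call \<open>x\<close> a pick from \<open>s\<close> if \<open>x\<close> lies in the last distance layer of \<open>s\<close> and, within that layer,
  has the fewest neighbours in the layer before. If the diameter is 4, then a pick from a pick
  from any vertex has eccentricity 4. For the proof, fix \<open>d(u, v) = 4\<close>. As every induced \<open>P\<^sub>4\<close>
  dominates the graph, the vertices split into consecutive classes \<open>A \<ni> u, B, C, D, E \<ni> v\<close> in
  which \<open>A\<close> is complete to \<open>B\<close> and \<open>D\<close> to \<open>E\<close>, so that all vertices of \<open>A\<close> and \<open>E\<close> have
  eccentricity 4; moreover \<open>A \<union> B \<union> C\<close> and \<open>C \<union> D \<union> E\<close> induce cographs. Cograph arguments show
  that a pick from \<open>B\<close> or \<open>D\<close> lies in \<open>E\<close> or \<open>A\<close>, and that a pick from \<open>C\<close> does not lie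
  in \<open>C\<close>. Since distances are at most 4, four passes over the adjacency lists compute all
  distances from a vertex without a queue.
\<close>

section \<open>Picks in graphs of diameter four\<close>

text \<open>\<open>d\<close> is abstract and natural-valued so that the locale can be instantiated
  both with \<open>gdist\<close> on the vertices of a graph and with the vertex numbers that the
  program handles. \<open>d_edge\<close> and \<open>d_pred\<close> make \<open>d u\<close> a
  breadth-first layering; \<open>d_pred\<close> and \<open>d_0\<close> also encode
  connectedness.\<close>

locale P4_P1_free_metric =
  fixes V :: "'a set" and E :: "'a \<Rightarrow> 'a \<Rightarrow> bool" and d :: "'a \<Rightarrow> 'a \<Rightarrow> nat"
  assumes fin: "finite V"
    and E_V: "E x y \<Longrightarrow> x \<in> V \<and> y \<in> V"
    and E_sym: "E x y \<Longrightarrow> E y x"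
    and d_self: "x \<in> V \<Longrightarrow> d x x = 0"
    and d_0: "x \<in> V \<Longrightarrow> y \<in> V \<Longrightarrow> d x y = 0 \<Longrightarrow> x = y"
    and d_sym: "x \<in> V \<Longrightarrow> y \<in> V \<Longrightarrow> d x y = d y x"
    and d_edge: "u \<in> V \<Longrightarrow> E x y \<Longrightarrow> d u y \<le> Suc (d u x)"
    and d_pred: "u \<in> V \<Longrightarrow> x \<in> V \<Longrightarrow> d u x = Suc k \<Longrightarrow> \<exists>y. E y x \<and> d u y = k"
    and P4_dominates: "E a b \<Longrightarrow> E b c \<Longrightarrow> E c e \<Longrightarrow> \<not> E a c \<Longrightarrow> \<not> E a e \<Longrightarrow> \<not> E b e \<Longrightarrow>
       x \<in> V \<Longrightarrow> E x a \<or> E x b \<or> E x c \<or> E x e"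
begin

definition back_degree :: "'a \<Rightarrow> 'a \<Rightarrow> nat" where
  "back_degree s x = card {z. E x z \<and> Suc (d s z) = d s x}"

definition pick :: "'a \<Rightarrow> 'a \<Rightarrow> bool" where
  "pick s x \<longleftrightarrow> x \<in> V \<and> (\<forall>y \<in> V. d s y \<le> d s x) \<and>
     (\<forall>y \<in> V. d s y = d s x \<longrightarrow> back_degree s x \<le> back_degree s y)"

lemma fin_nbrs: "finite {z. E x z \<and> P z}"
  by (rule finite_subset[OF _ fin]) (use E_V in blast)

lemma triangle: "x \<in> V \<Longrightarrow> y \<in> V \<Longrightarrow> z \<in> V \<Longrightarrow> d x z \<le> d x y + d y z"
proof (induction "d y z" arbitrary: z)
  case 0
  then show ?case using d_0 by fastforce
next
  case (Suc k)
  obtain w where w: "E w z" "d y w = k"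
    using d_pred[of y z k] Suc by metis
  have "d x w \<le> d x y + d y w" using Suc w E_V by blast
  then show ?case using d_edge[OF Suc.prems(1) w(1)] w Suc.hyps(2) by linarith
qed

lemma edge_dist: "E x y \<Longrightarrow> d x y \<le> 1"
  using d_edge[of x x y] d_self E_V by fastforce

lemma edge_dist': "x \<in> V \<Longrightarrow> y \<in> V \<Longrightarrow> d x y = 1 \<Longrightarrow> E x y"
  using d_pred[of x y 0] d_0 E_V by (metis One_nat_def)

lemma common_neighbour: "E x z \<Longrightarrow> E z y \<Longrightarrow> d x y \<le> 2"
  using d_edge[of x z y] edge_dist[of x z] E_V by fastforce

text \<open>On a shortest path to a vertex at distance 5, the vertices of layers 0 to 3 form an
  induced \<open>P4\<close> that does not dominate the end. A larger distance is reduced to 5 by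
  stepping back through predecessors.\<close>

lemma dist_le_4:
  assumes "u \<in> V" "x \<in> V"
  shows "d u x \<le> 4"
proof (rule ccontr)
  have 5: False if xV: "x \<in> V" and x: "d u x = 5" for x
  proof -
    obtain x4 where 4: "E x4 x" "d u x4 = 4" using d_pred[OF assms(1) xV, of 4] x by auto
    obtain x3 where 3: "E x3 x4" "d u x3 = 3" using d_pred[of u x4 3] 4 E_V assms by force
    obtain x2 where 2: "E x2 x3" "d u x2 = 2" using d_pred[of u x3 2] 3 E_V assms by force
    obtain x1 where 1: "E x1 x2" "d u x1 = 1" using d_pred[of u x2 1] 2 E_V assms by force
    have e: "\<not> E y z" if "Suc (d u y) < d u z" for y z
      using that d_edge[OF assms(1)] by fastforce
    have 0: "E u x1" using 1 edge_dist' E_V assms by blast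
    have s: "d u u = 0" using d_self assms by blast
    have "E x u \<or> E x x1 \<or> E x x2 \<or> E x x3"
      by (rule P4_dominates[OF 0 1(1) 2(1)]) (use e 1 2 3 s x xV in auto)
    moreover have "\<not> E u x" "\<not> E x1 x" "\<not> E x2 x" "\<not> E x3 x" using e 1 2 3 s x by auto
    ultimately show False using E_sym by blast
  qed
  assume "\<not> d u x \<le> 4"
  then have "5 \<le> d u x" by simp
  then have "\<exists>y \<in> V. d u y = 5" using assms(2)
  proof (induction "d u x" arbitrary: x rule: less_induct)
    case less
    show ?case
    proof (cases "d u x = 5")
      case False
      then obtain k where k: "d u x = Suc k" "5 \<le> k" using less.prems by (cases "d u x") auto
      obtain y where "E y x" "d u y = k" using d_pred[OF assms(1) less.prems(2) k(1)] by blast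
      then show ?thesis using less.hyps[of y] k E_V by auto
    qed (use less in blast)
  qed
  then show False using 5 by blast
qed

end

section \<open>The five distance classes around a pair at distance 4\<close>

text \<open>The vertex set splits into the five classes \<open>d v x = 4\<close>, \<open>d v x = 3\<close>,
  \<open>d u x = 2 = d v x\<close>, \<open>d u x = 3\<close> and \<open>d u x = 4\<close>, with edges only inside a class
  and between consecutive classes.\<close>

locale antipodal_pair = P4_P1_free_metric +
  fixes u v
  assumes u: "u \<in> V" and v: "v \<in> V" and uv: "d u v = 4"
begin

text \<open>Exchanging \<open>u\<close> and \<open>v\<close> reverses the order of the classes, so
  the interpretations \<open>sw\<close> below supply the mirror image of each fact.\<close>

lemma swapped: "antipodal_pair V E d v u"
  by unfold_locales (use u v uv d_sym in auto)

lemma far: "Suc (d w x) < d w y \<Longrightarrow> w \<in> V \<Longrightarrow> \<not> E x y \<and> \<not> E y x"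
  using d_edge[of w x y] E_sym by fastforce

lemma du_self: "d u u = 0" "d v v = 0" "d v u = 4"
  using d_self u v uv d_sym by auto

lemma sum_ge_4: "x \<in> V \<Longrightarrow> 4 \<le> d u x + d v x"
  using triangle[of u x v] u v uv d_sym by fastforce

text \<open>A shortest path from \<open>u\<close> to \<open>x\<close> is an induced
  \<open>P4\<close>, so \<open>y\<close> has a neighbour on it, and the layers leave only
  \<open>x\<close>. Thus class \<open>D\<close> is complete to class \<open>E\<close>; the mirror
  image joins \<open>B\<close> and \<open>A\<close>.\<close>

lemma layers_3_4:
  assumes x: "x \<in> V" "d u x = 3" and y: "y \<in> V" "d u y = 4"
  shows "E x y"
proof -
  obtain x2 where 2: "E x2 x" "d u x2 = 2" using d_pred[of u x 2] x u by auto
  obtain x1 where 1: "E x1 x2" "d u x1 = 1" using d_pred[of u x2 1] 2 E_V u by force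
  have 0: "E u x1" using 1 edge_dist' E_V u by blast
  have "E y u \<or> E y x1 \<or> E y x2 \<or> E y x"
    by (rule P4_dominates[OF 0 1(1) 2(1)]) (use far[of u] u 1 2 x y du_self in auto)
  moreover have "\<not> E y u" "\<not> E y x1" "\<not> E y x2"
    using far[of u _ y] u 1 2 y du_self by auto
  ultimately show ?thesis using E_sym by blast
qed

lemma dv_1: "x \<in> V \<Longrightarrow> d u x = 3 \<Longrightarrow> E x v \<and> d v x = 1"
proof -
  assume a: "x \<in> V" "d u x = 3"
  then have e: "E x v" using layers_3_4[OF _ _ v uv] by blast
  then have "d v x \<le> 1" using edge_dist E_sym by blast
  moreover have "d v x \<noteq> 0" using a uv v d_0[of v x] by force
  ultimately show ?thesis using e by simp
qed

text \<open>No vertex within distance 2 of \<open>u\<close> is adjacent to \<open>v\<close>, so an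
  induced \<open>P4\<close> among such vertices would fail to dominate \<open>v\<close>. This is the
  cograph property of the half around \<open>u\<close>.\<close>

lemma no_P4_near:
  assumes "E a b" "E b c" "E c e" "d u a \<le> 2" "d u b \<le> 2" "d u c \<le> 2" "d u e \<le> 2"
  shows "E a c \<or> E a e \<or> E b e"
proof -
  have "\<not> E v x" if "d u x \<le> 2" for x using far[of u x v] u uv that by simp
  then show ?thesis using P4_dominates[OF assms(1-3) _ _ _ v] assms(4-) by blast
qed

lemma centre_near:
  assumes "x \<in> V" "d u x = 2" "d v x = 2"
  obtains y where "E y x" "d u y = 1" "d v y = 3"
proof -
  obtain y where y: "E y x" "d u y = 1" using d_pred[of u x 1] assms u by auto
  moreover have "4 \<le> d u y + d v y" using sum_ge_4 y E_V by blast
  moreover have "d v y \<le> 3" using d_edge[of v x y] E_sym y v assms by force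
  ultimately show ?thesis using that by auto
qed

lemma near_centre:
  assumes "x \<in> V" "d v x = 3" "d u x = 1"
  obtains y where "E y x" "d u y = 2" "d v y = 2"
proof -
  obtain y where y: "E y x" "d v y = 2" using d_pred[of v x 2] assms v by auto
  moreover have "4 \<le> d u y + d v y" using sum_ge_4 y E_V by blast
  moreover have "d u y \<le> 2" using d_edge[of u x y] E_sym y u assms by force
  ultimately show ?thesis using that by auto
qed

end

section \<open>Picks from the classes \<open>B\<close>, \<open>C\<close> and
  \<open>D\<close>\<close>

context antipodal_pair
begin

interpretation sw: antipodal_pair V E d v u by (rule swapped)

text \<open>Both distances are at most 4 and their sum is at least 4; by \<open>dv_1\<close> and its
  mirror image, distance 3 from one end forces distance 1 from the other.\<close>

lemma classes:
  assumes "x \<in> V"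
  obtains "d v x = 4" | "d v x = 3" "d u x = 1" | "d u x = 2" "d v x = 2"
    | "d u x = 3" "d v x = 1" | "d u x = 4"
proof -
  have "d u x \<le> 4" "d v x \<le> 4" using dist_le_4 u v assms by auto
  moreover have "4 \<le> d u x + d v x" using sum_ge_4 assms by blast
  moreover have "d u x = 3 \<Longrightarrow> d v x = 1" using dv_1 assms by blast
  moreover have "d v x = 3 \<Longrightarrow> d u x = 1" using sw.dv_1 assms by blast
  ultimately have "d v x = 4 \<or> (d v x = 3 \<and> d u x = 1) \<or> (d u x = 2 \<and> d v x = 2)
    \<or> (d u x = 3 \<and> d v x = 1) \<or> d u x = 4" by linarith
  then show thesis using that by blast
qed

text \<open>If \<open>y\<close> is a neighbour of \<open>x\<close> in class \<open>B\<close>, the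
  path \<open>s\<close>, \<open>u\<close>, \<open>y\<close>, \<open>x\<close> lies within distance 2
  of \<open>u\<close>. It is not induced, so \<open>y\<close> is adjacent to \<open>s\<close> unless
  \<open>x\<close> is.\<close>

lemma near_dist_centre:
  assumes "s \<in> V" "d v s = 3" "d u s = 1" "x \<in> V" "d u x = 2" "d v x = 2"
  shows "d s x \<le> 2"
proof (cases "E s x")
  case True
  then show ?thesis using edge_dist by fastforce
next
  case False
  obtain y where y: "E y x" "d u y = 1" "d v y = 3" using centre_near assms by metis
  have su: "E s u" using sw.dv_1 assms by blast
  have uy: "E u y" using sw.dv_1 y E_V E_sym by blast
  have nux: "\<not> E u x" using far[of v x u] v du_self assms by auto
  have "E s y"
    using no_P4_near[OF su uy y(1)] assms y du_self False nux by auto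
  then show ?thesis using common_neighbour y by blast
qed

text \<open>Either alternative gives the pick eccentricity 4. Otherwise \<open>x\<close> has the
  same distance 3 from \<open>s\<close> as \<open>v\<close>, which places it in class
  \<open>D\<close>; then \<open>v\<close> has fewer neighbours in the previous layer, against the
  choice of \<open>x\<close>.\<close>

lemma pick_from_near:
  assumes s: "s \<in> V" "d v s = 3" and p: "pick s x"
  shows "d u x = 4 \<or> d s x = 4"
proof (rule ccontr)
  assume "\<not> ?thesis"
  then have n: "d u x \<noteq> 4" "d s x \<noteq> 4" by auto
  have x: "x \<in> V" using p pick_def by blast
  have su: "E s u" "d u s = 1" using sw.dv_1 s by auto
  have sv: "d s v = 3" using s v d_sym by auto
  then have "3 \<le> d s x" using p v unfolding pick_def by metis
  then have sx: "d s x = 3" using n dist_le_4[OF s(1) x] by linarith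
  have "d u x = 3 \<and> d v x = 1"
    using x
  proof (cases rule: classes)
    case 1
    then have "E s x" using sw.layers_3_4 s x by blast
    then show ?thesis using edge_dist sx by fastforce
  next
    case 2
    then have "E u x" using sw.dv_1 x E_sym by blast
    then show ?thesis using common_neighbour su sx by fastforce
  next
    case 3
    then show ?thesis using near_dist_centre[OF s su(2) x] sx by auto
  qed (use n in auto)
  then have D: "d u x = 3" "d v x = 1" by auto
  obtain c' where c': "E c' x" "d v c' = 2" "d u c' = 2"
    using sw.near_centre[of x] x D by metis
  have c'V: "c' \<in> V" using c' E_V by blast
  \<comment> \<open>Strictness comes from \<open>c'\<close>: it is a neighbour of \<open>x\<close>
    in class \<open>C\<close>, and \<open>v\<close> has no neighbours there.\<close>
  have "{z. E v z \<and> Suc (d s z) = d s v} \<subset> {z. E x z \<and> Suc (d s z) = d s x}"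
  proof (rule psubsetI[OF subsetI])
    fix z assume "z \<in> {z. E v z \<and> Suc (d s z) = d s v}"
    then have z: "E v z" "d s z = 2" using sv by auto
    have zV: "z \<in> V" using z E_V by blast
    have "d u z \<noteq> 4" using triangle[of u s z] u s zV su z by auto
    moreover have "3 \<le> d u z" using d_edge[of u z v] z E_sym u uv by fastforce
    ultimately have uz: "d u z = 3" using dist_le_4[OF u zV] by linarith
    obtain c where c: "E c z" "d s c = 1" using d_pred[of s z 1] s z zV by auto
    then have sc: "E s c" using edge_dist' s E_V by blast
    have uc: "d u c = 2" using d_edge[OF u sc] d_edge[OF u c(1)] su uz by linarith
    have vc: "d v c \<le> 2" using d_edge[of v z c] c E_sym v dv_1[OF zV uz] by force
    have nxc: "\<not> E x c" using common_neighbour[OF sc, of x] E_sym sx by fastforce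
    have nvc: "\<not> E v c" using far[of u c v] u uv uc by auto
    \<comment> \<open>Without this edge, \<open>x\<close>, \<open>v\<close>, \<open>z\<close>,
      \<open>c\<close> would be an induced \<open>P4\<close> in the half around
      \<open>v\<close>.\<close>
    have "E x z"
      using sw.no_P4_near[of x v z c] dv_1[OF x D(1)] z c E_sym vc D dv_1[OF zV uz] nxc nvc du_self
      by auto
    then show "z \<in> {z. E x z \<and> Suc (d s z) = d s x}" using z sx by simp
  next
    have "d s c' \<le> 2" using near_dist_centre[OF s su(2) c'V c'(3,2)] .
    moreover have "2 \<le> d s c'" using d_edge[OF s(1) c'(1)] sx by simp
    ultimately have "c' \<in> {z. E x z \<and> Suc (d s z) = d s x}" using c' sx E_sym by auto
    moreover have "\<not> E v c'" using far[of u c' v] u uv c' by auto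
    ultimately show "{z. E v z \<and> Suc (d s z) = d s v} \<noteq> {z. E x z \<and> Suc (d s z) = d s x}" by blast
  qed
  then have "back_degree s v < back_degree s x"
    unfolding back_degree_def by (rule psubset_card_mono[OF fin_nbrs])
  then show False using p v sv sx unfolding pick_def by fastforce
qed

text \<open>Take neighbours \<open>b\<close> of \<open>s\<close> and \<open>b'\<close> of
  \<open>x\<close> in class \<open>B\<close>; both are adjacent to \<open>u\<close>. If neither is
  shared, the path \<open>s\<close>, \<open>b\<close>, \<open>u\<close>, \<open>b'\<close> forces an
  edge between \<open>b\<close> and \<open>b'\<close>, and then \<open>s\<close>, \<open>b\<close>,
  \<open>b'\<close>, \<open>x\<close> is a forbidden \<open>P4\<close>.\<close>

lemma centre_common_neighbour:
  assumes "s \<in> V" "d u s = 2" "d v s = 2" "x \<in> V" "d u x = 2" "d v x = 2" "\<not> E s x"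
  obtains b where "E s b" "E x b" "d u b = 1" "d v b = 3"
proof -
  obtain b where b: "E b s" "d u b = 1" "d v b = 3" using centre_near assms by metis
  obtain b' where b': "E b' x" "d u b' = 1" "d v b' = 3" using centre_near assms by metis
  have bb: "E b u" "E u b'" using sw.dv_1 b b' E_V E_sym by blast+
  have ns: "\<not> E s u" "\<not> E u x" using far[of v _ u] v du_self assms by auto
  consider "E x b" | "E s b'" | "\<not> E x b" "\<not> E s b'" by blast
  then show thesis
  proof cases
    case 3
    have sb: "E s b" "E b' s \<longrightarrow> E s b'" using b E_sym by blast+
    have "E b b'" using no_P4_near[OF sb(1) bb] 3 ns b b' assms du_self by auto
    then have False
      using no_P4_near[OF sb(1) _ b'(1)] 3 ns b b' assms E_sym by auto
    then show thesis ..
  qed (use that b b' E_sym in blast)+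
qed

end

text \<open>Reopening the context makes the lemmas just proved available through \<open>sw\<close>
  as well.\<close>

context antipodal_pair
begin

interpretation sw: antipodal_pair V E d v u by (rule swapped)

text \<open>The neighbours of \<open>u\<close> next to \<open>s\<close> lie in class
  \<open>B\<close>, so by the last assumption they all count for \<open>x\<close>. In addition
  \<open>x\<close> shares with \<open>s\<close> a neighbour in class \<open>D\<close>, which is too
  far from \<open>u\<close>.\<close>

lemma back_degree_centre_less:
  assumes s: "s \<in> V" "d u s = 2" "d v s = 2" and x: "x \<in> V" "d u x = 2" "d v x = 2"
    and n: "d s x = 2" and c: "\<And>b. E s b \<Longrightarrow> d u b = 1 \<Longrightarrow> d v b = 3 \<Longrightarrow> E x b"
  shows "back_degree s u < back_degree s x"
proof -
  have su: "d s u = 2" using s u d_sym by auto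
  have "\<not> E s x" using edge_dist n by fastforce
  then obtain b where b: "E s b" "E x b" "d v b = 1" "d u b = 3"
    using sw.centre_common_neighbour s x by metis
  have "{z. E u z \<and> Suc (d s z) = d s u} \<subset> {z. E x z \<and> Suc (d s z) = d s x}"
  proof (rule psubsetI[OF subsetI])
    fix z assume "z \<in> {z. E u z \<and> Suc (d s z) = d s u}"
    then have z: "E u z" "d s z = 1" using su by auto
    then have sz: "E s z" using edge_dist' s E_V by blast
    have "d u z \<le> 1" using edge_dist z by blast
    moreover have "d v z \<le> 3" using d_edge[OF v sz] s by simp
    moreover have "4 \<le> d u z + d v z" using sum_ge_4 z E_V by blast
    ultimately have "E x z" using c[OF sz] by linarith
    then show "z \<in> {z. E x z \<and> Suc (d s z) = d s x}" using z n by simp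
  next
    have "d s b \<le> 1" using edge_dist b by blast
    moreover have "d s b \<noteq> 0" using d_0[of s b] s b E_V by fastforce
    ultimately have "b \<in> {z. E x z \<and> Suc (d s z) = d s x}" using b n by auto
    moreover have "\<not> E u b" using far[of u u b] u b du_self by auto
    ultimately show "{z. E u z \<and> Suc (d s z) = d s u} \<noteq> {z. E x z \<and> Suc (d s z) = d s x}" by blast
  qed
  then show ?thesis
    unfolding back_degree_def by (rule psubset_card_mono[OF fin_nbrs])
qed

end

context antipodal_pair
begin

interpretation sw: antipodal_pair V E d v u by (rule swapped)

text \<open>Suppose that \<open>s\<close> has a neighbour \<open>b\<close> in \<open>B\<close> and a
  neighbour \<open>e\<close> in \<open>D\<close>, both not adjacent to \<open>x\<close>. Then the
  induced path \<open>u\<close>, \<open>b\<close>, \<open>s\<close>, \<open>e\<close> does not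
  dominate \<open>x\<close>. So the neighbours of \<open>s\<close> on one side are all adjacent to
  \<open>x\<close>, and the end on that side beats \<open>x\<close> as a pick.\<close>

lemma pick_from_centre:
  assumes s: "s \<in> V" "d u s = 2" "d v s = 2" and p: "pick s x"
  shows "\<not> (d u x = 2 \<and> d v x = 2)"
proof
  assume x2: "d u x = 2 \<and> d v x = 2"
  have x: "x \<in> V" using p pick_def by blast
  have su: "d s u = 2" "d s v = 2" using s u v d_sym by auto
  then have 2: "2 \<le> d s x" using p u unfolding pick_def by metis
  then have nsx: "\<not> E s x" using edge_dist by fastforce
  obtain b where "E s b" "E x b" using centre_common_neighbour s x x2 nsx by metis
  then have sx: "d s x = 2" using common_neighbour E_sym 2 le_antisym by blast
  have "(\<forall>b. E s b \<longrightarrow> d u b = 1 \<longrightarrow> d v b = 3 \<longrightarrow> E x b) \<or>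
        (\<forall>b. E s b \<longrightarrow> d v b = 1 \<longrightarrow> d u b = 3 \<longrightarrow> E x b)"
  proof (rule ccontr)
    assume "\<not> ?thesis"
    then obtain b e where b: "E s b" "d u b = 1" "d v b = 3" "\<not> E x b"
      and e: "E s e" "d v e = 1" "d u e = 3" "\<not> E x e" by blast
    have ub: "E u b" using sw.dv_1 b E_V E_sym by blast
    have "\<not> E u s" "\<not> E u e" "\<not> E b e" "\<not> E x u" "\<not> E x s"
      using far[of v _ u] far[of u b e] u v du_self s e b x2 nsx E_sym by auto
    then show False using P4_dominates[OF ub _ e(1), of x] b e E_sym x by blast
  qed
  then have "back_degree s u < back_degree s x \<or> back_degree s v < back_degree s x"
    using back_degree_centre_less[OF s x _ _ sx] sw.back_degree_centre_less[OF s(1,3,2) x _ _ sx] x2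
    by blast
  then show False using p su sx u v unfolding pick_def by fastforce
qed

text \<open>One pick leaves class \<open>C\<close>, and one pick from \<open>B\<close> or
  \<open>D\<close> reaches eccentricity 4; from then on it is kept.\<close>

lemma pick_pick:
  assumes s: "s \<in> V" and p: "pick s x" "pick x y"
  shows "\<exists>z \<in> V. d y z = 4"
proof -
  have xy: "x \<in> V" "y \<in> V" using p pick_def by auto
  \<comment> \<open>A pick lies in the last layer, so it inherits eccentricity 4 from its
    source.\<close>
  have g: "\<exists>z \<in> V. d y z = 4" if "\<exists>z \<in> V. d x z = 4"
    using that p(2) dist_le_4 xy d_sym unfolding pick_def by (metis order_antisym)
  have g0: "\<exists>z \<in> V. d x z = 4" if "\<exists>z \<in> V. d s z = 4"
    using that p(1) dist_le_4 xy s d_sym unfolding pick_def by (metis order_antisym)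
  have B: "\<exists>z \<in> V. d b z = 4" if "a \<in> V" "d v a = 3 \<or> d u a = 3" "pick a b" for a b
    using that pick_from_near[of a b] sw.pick_from_near[of a b] d_sym u v pick_def by metis
  show ?thesis
    using s
  proof (cases rule: classes)
    case 3
    then have c: "\<not> (d u x = 2 \<and> d v x = 2)" using pick_from_centre s p by blast
    show ?thesis
      using xy(1)
    proof (cases rule: classes)
      case 1 then show ?thesis using g xy v d_sym by metis
    next
      case 5 then show ?thesis using g xy u d_sym by metis
    qed (use c B xy p in blast)+
  next
    case 1 then show ?thesis using g g0 s v d_sym by metis
  next
    case 5 then show ?thesis using g g0 s u d_sym by metis
  qed (use B g s p in blast)+
qed

end

section \<open>Distances in connected graphs without induced \<open>P\<^sub>4 + P\<^sub>1\<close>\<close>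

text \<open>Natural-number counterpart of \<open>graph_dist\<close>. The value is meaningful only if
  some path exists, so the lemmas on distinct end points carry a path as hypothesis.\<close>

definition gdist :: "'a graph \<Rightarrow> 'a \<Rightarrow> 'a \<Rightarrow> nat" where
  "gdist G u v = (LEAST k. \<exists>p. path_between G u p v \<and> length p = Suc k)"

lemma path_between_length: "path_between G u p v \<Longrightarrow> length p = Suc (length p - 1)"
  by (cases p) (auto simp: path_between_def)

lemma gdist_le: "path_between G u p v \<Longrightarrow> gdist G u v \<le> length p - 1"
  unfolding gdist_def using path_between_length by (intro Least_le exI[of _ p] conjI)

lemma gdist_path:
  assumes "path_between G u p v"
  obtains q where "path_between G u q v" "length q = Suc (gdist G u v)"
proof -
  have "\<exists>q. path_between G u q v \<and> length q = Suc (length p - 1)"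
    using assms path_between_length by (intro exI[of _ p] conjI)
  then have "\<exists>q. path_between G u q v \<and> length q = Suc (gdist G u v)"
    unfolding gdist_def by (rule LeastI)
  then show thesis using that by blast
qed

lemma graph_dist_eq_gdist:
  assumes "path_between G u p v"
  shows "graph_dist G u v = enat (gdist G u v)"
proof -
  obtain q where q: "path_between G u q v" "length q = Suc (gdist G u v)"
    using gdist_path assms by metis
  show ?thesis unfolding graph_dist_def
  proof (rule antisym)
    show "Inf {enat (length p - 1) |p. path_between G u p v} \<le> enat (gdist G u v)"
      using q by (intro Inf_lower) force
    show "enat (gdist G u v) \<le> Inf {enat (length p - 1) |p. path_between G u p v}"
      using gdist_le by (intro Inf_greatest) fastforce
  qed
qed

lemma path_between_single: "u \<in> verts G \<Longrightarrow> path_between G u [u] u"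
  by (auto simp: path_between_def)

lemma path_between_rev:
  assumes "path_between G u p v"
  shows "path_between G v (rev p) u"
proof -
  have "{rev p ! i, rev p ! Suc i} \<in> edges G" if "Suc i < length p" for i
  proof -
    have "rev p ! i = p ! Suc (length p - Suc (Suc i))" "rev p ! Suc i = p ! (length p - Suc (Suc i))"
      using that by (auto simp: rev_nth Suc_diff_Suc)
    moreover have "{p ! (length p - Suc (Suc i)), p ! Suc (length p - Suc (Suc i))} \<in> edges G"
      using assms that unfolding path_between_def by simp
    ultimately show ?thesis by (simp add: insert_commute)
  qed
  then show ?thesis using assms unfolding path_between_def by (auto simp: hd_rev last_rev)
qed

lemma path_between_prefix:
  assumes "path_between G u p v" "i < length p"
  shows "path_between G u (take (Suc i) p) (p ! i)"
proof -
  have "last (take (Suc i) p) = p ! i" using assms(2) by (simp add: take_Suc_conv_app_nth)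
  then show ?thesis using assms set_take_subset[of "Suc i" p]
    by (auto simp: path_between_def)
qed

lemma path_between_snoc:
  assumes "path_between G u p v" "{v, w} \<in> edges G" "w \<in> verts G" "w \<notin> set p"
  shows "path_between G u (p @ [w]) w"
proof -
  have "{(p @ [w]) ! i, (p @ [w]) ! Suc i} \<in> edges G" if "i < length p" for i
  proof (cases "Suc i = length p")
    case True
    then have "p ! i = v" using assms by (auto simp: path_between_def last_conv_nth simp flip: True)
    then show ?thesis using True assms by (simp add: nth_append)
  next
    case False
    then show ?thesis using that assms by (simp add: nth_append path_between_def)
  qed
  then show ?thesis using assms by (auto simp: path_between_def)
qed

lemma gdist_sym:
  assumes "path_between G u p v"
  shows "gdist G u v = gdist G v u"
  using assms gdist_path gdist_le path_between_rev
  by (metis diff_Suc_1 length_rev order_antisym)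

text \<open>Paths are distinct, so \<open>w\<close> extends a shortest path only if it is not on it;
  otherwise the prefix ending in \<open>w\<close> is short enough.\<close>

lemma gdist_edge:
  assumes "path_between G u p v" "{v, w} \<in> edges G" "w \<in> verts G"
  shows "gdist G u w \<le> Suc (gdist G u v)"
proof -
  obtain q where q: "path_between G u q v" "length q = Suc (gdist G u v)"
    using gdist_path assms by metis
  show ?thesis
  proof (cases "w \<in> set q")
    case True
    then obtain i where i: "i < length q" "q ! i = w" by (auto simp: in_set_conv_nth)
    then show ?thesis using gdist_le[OF path_between_prefix[OF q(1) i(1)]] q(2) by simp
  next
    case False
    then show ?thesis using gdist_le[OF path_between_snoc[OF q(1) assms(2,3)]] q(2) by simp
  qed
qed

lemma gdist_pred:
  assumes "path_between G u p v" "gdist G u v = Suc k"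
  shows "\<exists>w. {w, v} \<in> edges G \<and> w \<in> verts G \<and> gdist G u w = k"
proof -
  obtain q where q: "path_between G u q v" "length q = Suc (Suc k)"
    using gdist_path assms by metis
  have v: "q ! Suc k = v" "v \<in> verts G" using q by (auto simp: path_between_def last_conv_nth)
  have w: "{q ! k, v} \<in> edges G" "q ! k \<in> verts G"
    using q v unfolding path_between_def by (fastforce intro: nth_mem)+
  have p: "path_between G u (take (Suc k) q) (q ! k)" using path_between_prefix q by fastforce
  have "gdist G u (q ! k) \<le> k" using gdist_le[OF p] q by simp
  moreover have "Suc k \<le> Suc (gdist G u (q ! k))"
    using gdist_edge[OF p w(1) v(2)] assms(2) by simp
  ultimately show ?thesis using w by auto
qed

lemma gdist_0:
  assumes "path_between G u p v" "gdist G u v = 0"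
  shows "u = v"
proof -
  obtain q where "path_between G u q v" "length q = 1"
    using gdist_path assms by (metis One_nat_def)
  then show ?thesis by (auto simp: path_between_def length_Suc_conv)
qed

lemma gdist_self: "u \<in> verts G \<Longrightarrow> gdist G u u = 0"
  using gdist_le[OF path_between_single] by fastforce

section \<open>From the graph class to the locale, and the diameter\<close>

lemma free_P4_plus_P1_dominates:
  assumes G: "simple_graph G" "free_of P4_plus_P1 G"
    and e: "{a, b} \<in> edges G" "{b, c} \<in> edges G" "{c, f} \<in> edges G"
      "{a, c} \<notin> edges G" "{a, f} \<notin> edges G" "{b, f} \<notin> edges G"
    and x: "x \<in> verts G" "{x, a} \<notin> edges G" "{x, b} \<notin> edges G" "{x, c} \<notin> edges G" "{x, f} \<notin> edges G"
  shows False
proof -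
  have E: "y \<in> verts G \<and> z \<in> verts G \<and> y \<noteq> z" if "{y, z} \<in> edges G" for y z
    using G(1) that unfolding simple_graph_def by (metis card_2_iff doubleton_eq_iff insert_subset)
  \<comment> \<open>\<open>graph_iso\<close> also compares pairs of equal vertices, whose image is a
    singleton.\<close>
  have ne: "{y} \<notin> edges G" for y
    using G(1) unfolding simple_graph_def by fastforce
  have dist: "distinct [a, b, c, f, x]"
    using E e x by (auto simp: insert_commute)
  let ?S = "{a, b, c, f, x}"
  let ?f = "\<lambda>y. case y of Inl i \<Rightarrow> [a, b, c, f] ! i | Inr _ \<Rightarrow> x"
  have V: "verts P4_plus_P1 = {Inl 0, Inl 1, Inl 2, Inl 3, Inr 0}"
    by (auto simp: P4_plus_P1_def disjoint_union_def path_graph_def)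
  have "{{i, Suc i} |i. Suc i < (4::nat)} = (\<lambda>i. {i, Suc i}) ` {0, 1, 2}"
    by (auto simp: image_def)
  also have "\<dots> = {{0, 1}, {1, 2}, {2, 3}}" by (simp add: numeral_2_eq_2 numeral_3_eq_3)
  finally have "{{i, Suc i} |i. Suc i < (4::nat)} = {{0, 1}, {1, 2}, {2, 3}}" .
  then have EP: "edges P4_plus_P1 = {{Inl 0, Inl 1}, {Inl 1, Inl 2}, {Inl 2, Inl 3}}"
    by (auto simp: P4_plus_P1_def disjoint_union_def path_graph_def)
  have "bij_betw ?f (verts P4_plus_P1) ?S"
    unfolding V bij_betw_def inj_on_def using dist by auto
  moreover have "\<forall>y \<in> verts P4_plus_P1. \<forall>z \<in> verts P4_plus_P1.
      {y, z} \<in> edges P4_plus_P1 \<longleftrightarrow> {?f y, ?f z} \<in> edges G \<and> {?f y, ?f z} \<subseteq> ?S"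
    unfolding V EP using e x dist ne by (auto simp: insert_commute doubleton_eq_iff)
  ultimately have "graph_iso P4_plus_P1 (induced_subgraph G ?S)"
    unfolding graph_iso_def induced_subgraph_def by auto
  moreover have "?S \<subseteq> verts G" using E e x by blast
  ultimately show False using G(2) unfolding free_of_def by blast
qed

lemma P4_P1_free_metric_gdist:
  assumes G: "G \<in> connected_P4_P1_free"
  shows "P4_P1_free_metric (verts G) (\<lambda>x y. {x, y} \<in> edges G) (gdist G)"
proof -
  have G': "simple_graph G" "connected_graph G" "free_of P4_plus_P1 G"
    using G connected_P4_P1_free_def by auto
  have V: "x \<in> verts G \<and> y \<in> verts G" if "{x, y} \<in> edges G" for x y
    using G'(1) that unfolding simple_graph_def by auto
  have conn: "\<exists>p. path_between G x p y" if "x \<in> verts G" "y \<in> verts G" for x y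
    using G'(2) that unfolding connected_graph_def by blast
  show ?thesis
  proof
    show "finite (verts G)" using G'(1) simple_graph_def by blast
    show "x \<in> verts G \<and> y \<in> verts G" if "{x, y} \<in> edges G" for x y using V that .
    show "{y, x} \<in> edges G" if "{x, y} \<in> edges G" for x y using that by (simp add: insert_commute)
    show "gdist G x x = 0" if "x \<in> verts G" for x using gdist_self that .
    show "x = y" if "x \<in> verts G" "y \<in> verts G" "gdist G x y = 0" for x y
      using gdist_0[OF _ that(3)] conn[OF that(1,2)] by blast
    show "gdist G x y = gdist G y x" if "x \<in> verts G" "y \<in> verts G" for x y
      using gdist_sym conn that by metis
    show "gdist G u y \<le> Suc (gdist G u x)" if "u \<in> verts G" "{x, y} \<in> edges G" for u x y
      using gdist_edge conn that V by metis
    show "\<exists>y. {y, x} \<in> edges G \<and> gdist G u y = k"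
      if "u \<in> verts G" "x \<in> verts G" "gdist G u x = Suc k" for u x k
      using gdist_pred conn that by metis
    show "{x, a} \<in> edges G \<or> {x, b} \<in> edges G \<or> {x, c} \<in> edges G \<or> {x, e} \<in> edges G"
      if "{a, b} \<in> edges G" "{b, c} \<in> edges G" "{c, e} \<in> edges G"
        "{a, c} \<notin> edges G" "{a, e} \<notin> edges G" "{b, e} \<notin> edges G" "x \<in> verts G" for a b c e x
      using free_P4_plus_P1_dominates[OF G'(1,3) that] by blast
  qed
qed

text \<open>Used with \<open>f\<close> the indexing of the vertex list. The new relation mentions
  \<open>W\<close> because \<open>f\<close> is arbitrary outside \<open>W\<close>.\<close>

lemma P4_P1_free_metric_reindex:
  assumes "P4_P1_free_metric V E d" and f: "bij_betw f W V"
  shows "P4_P1_free_metric W (\<lambda>i j. i \<in> W \<and> j \<in> W \<and> E (f i) (f j)) (\<lambda>i j. d (f i) (f j))"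
proof -
  interpret P4_P1_free_metric V E d by fact
  have fV: "f i \<in> V" if "i \<in> W" for i using f that bij_betw_apply by metis
  show ?thesis
  proof
    show "finite W" using fin f bij_betw_finite by blast
    show "x = y" if "x \<in> W" "y \<in> W" "d (f x) (f y) = 0" for x y
      using that d_0 fV f unfolding bij_betw_def inj_on_def by blast
    show "\<exists>y. (y \<in> W \<and> x \<in> W \<and> E (f y) (f x)) \<and> d (f u) (f y) = k"
      if ux: "u \<in> W" "x \<in> W" "d (f u) (f x) = Suc k" for u x k
    proof -
      obtain z where "E z (f x)" "d (f u) z = k" using d_pred[OF fV[OF ux(1)] fV[OF ux(2)] ux(3)] by blast
      moreover from this obtain y where "y \<in> W" "f y = z"
        using E_V f unfolding bij_betw_def by blast
      ultimately show ?thesis using ux by blast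
    qed
  next
    fix a b c e x
    let ?E = "\<lambda>i j. i \<in> W \<and> j \<in> W \<and> E (f i) (f j)"
    assume "?E a b" "?E b c" "?E c e" "\<not> ?E a c" "\<not> ?E a e" "\<not> ?E b e" and "x \<in> W"
    then show "?E x a \<or> ?E x b \<or> ?E x c \<or> ?E x e"
      using P4_dominates[of "f a" "f b" "f c" "f e" "f x"] fV by blast
  qed (simp_all add: fV d_self d_sym d_edge E_sym)
qed

lemma graph_dist_gdist:
  assumes "G \<in> connected_P4_P1_free" "u \<in> verts G" "v \<in> verts G"
  shows "graph_dist G u v = enat (gdist G u v)"
proof -
  obtain p where "path_between G u p v"
    using assms by (auto simp: connected_P4_P1_free_def connected_graph_def)
  then show ?thesis by (rule graph_dist_eq_gdist)
qed

lemma diam_facts: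
  assumes G: "G \<in> connected_P4_P1_free"
  shows diam_le_4: "diam G \<le> 4"
    and diam_eq_4: "diam G = 4 \<longleftrightarrow> (\<exists>u \<in> verts G. \<exists>v \<in> verts G. gdist G u v = 4)"
proof -
  interpret P4_P1_free_metric "verts G" "\<lambda>x y. {x, y} \<in> edges G" "gdist G"
    using P4_P1_free_metric_gdist[OF G] .
  let ?D = "{graph_dist G u v |u v. u \<in> verts G \<and> v \<in> verts G}"
  have D: "?D = (\<lambda>(u, v). enat (gdist G u v)) ` (verts G \<times> verts G)"
    using graph_dist_gdist[OF G] by force
  have "verts G \<noteq> {}" using G by (auto simp: connected_P4_P1_free_def connected_graph_def)
  then have ne: "finite ?D" "?D \<noteq> {}" unfolding D using fin by auto
  have 4: "\<forall>x \<in> ?D. x \<le> 4" unfolding D using dist_le_4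
    by (auto simp: numeral_eq_enat)
  then show "diam G \<le> 4" unfolding diam_def using ne by auto
  have "diam G = 4 \<longleftrightarrow> 4 \<in> ?D" unfolding diam_def
    using Max_in[OF ne] 4 by (metis (no_types, lifting) Max_eqI ne(1))
  also have "\<dots> \<longleftrightarrow> (\<exists>u \<in> verts G. \<exists>v \<in> verts G. gdist G u v = 4)"
    unfolding D by (force simp: numeral_eq_enat)
  finally show "diam G = 4 \<longleftrightarrow> (\<exists>u \<in> verts G. \<exists>v \<in> verts G. gdist G u v = 4)" .
qed

section \<open>The path on five vertices attains the maximum\<close>

lemma edges_path_graph: "{u, v} \<in> edges (path_graph n) \<longleftrightarrow> (v = Suc u \<and> v < n) \<or> (u = Suc v \<and> u < n)"
  by (auto simp: path_graph_def doubleton_eq_iff)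

lemma path_graph_path:
  assumes "i \<le> j" "j < n"
  shows "path_between (path_graph n) i [i..<Suc j] j"
  unfolding path_between_def edges_path_graph using assms
  by (auto simp: path_graph_def hd_append simp del: upt_Suc)

text \<open>The forbidden graph has five vertices, so an induced copy would use the whole path, and
  its isolated vertex would be sent to a vertex with a neighbour.\<close>

lemma P5_in_class: "path_graph 5 \<in> connected_P4_P1_free"
proof -
  have "simple_graph (path_graph 5)" by (auto simp: simple_graph_def path_graph_def)
  moreover have "connected_graph (path_graph 5)"
    unfolding connected_graph_def
  proof (intro conjI ballI)
    show "verts (path_graph 5) \<noteq> {}" by (simp add: path_graph_def lessThan_empty_iff)
    fix u v assume "u \<in> verts (path_graph 5)" "v \<in> verts (path_graph 5)"
    then have uv: "u < 5" "v < 5" by (auto simp: path_graph_def)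
    show "\<exists>p. path_between (path_graph 5) u p v"
      using path_graph_path[of u v 5] path_between_rev[OF path_graph_path[of v u 5]] uv
      by (metis nle_le)
  qed
  moreover have "free_of P4_plus_P1 (path_graph 5)"
    unfolding free_of_def
  proof
    assume "\<exists>S\<subseteq>verts (path_graph 5). graph_iso P4_plus_P1 (induced_subgraph (path_graph 5) S)"
    then obtain S f where S: "S \<subseteq> {..<5}" and f: "bij_betw f (verts P4_plus_P1) S"
      and e: "\<And>u v. u \<in> verts P4_plus_P1 \<Longrightarrow> v \<in> verts P4_plus_P1 \<Longrightarrow>
        {u, v} \<in> edges P4_plus_P1 \<longleftrightarrow> {f u, f v} \<in> edges (path_graph 5) \<and> {f u, f v} \<subseteq> S"
      unfolding graph_iso_def induced_subgraph_def by (auto simp: path_graph_def)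
    have V: "verts P4_plus_P1 = {Inl 0, Inl 1, Inl 2, Inl 3, Inr 0}"
      by (auto simp: P4_plus_P1_def disjoint_union_def path_graph_def)
    have "card S = 5" using bij_betw_same_card[OF f] V by simp
    then have S5: "S = {..<5}" using S by (intro card_subset_eq) auto
    let ?x = "f (Inr 0)"
    define y where "y = (if ?x = 0 then 1 else ?x - 1)"
    have x5: "?x < 5" using f S5 V by (auto simp: bij_betw_def)
    then have xy: "{?x, y} \<in> edges (path_graph 5)" "y \<in> S"
      unfolding edges_path_graph S5 y_def by auto
    then obtain z where "z \<in> verts P4_plus_P1" "f z = y" using f unfolding bij_betw_def by blast
    then have "{Inr 0, z} \<in> edges P4_plus_P1" using e[of "Inr 0" z] xy x5 S5 V by auto
    then show False by (auto simp: P4_plus_P1_def disjoint_union_def path_graph_def)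
  qed
  ultimately show ?thesis by (simp add: connected_P4_P1_free_def)
qed

text \<open>Vertex labels grow by at most 1 along an edge, so a path from 0 to 4 has at least four
  edges.\<close>

lemma diam_P5: "diam (path_graph 5) = 4"
proof -
  have V: "0 \<in> verts (path_graph 5)" "4 \<in> verts (path_graph 5)" by (auto simp: path_graph_def)
  obtain q where q: "path_between (path_graph 5) 0 q 4" "length q = Suc (gdist (path_graph 5) 0 4)"
    using gdist_path[OF path_graph_path[of 0 4 5]] by auto
  have "q ! i \<le> i" if "i < length q" for i
    using that
  proof (induction i)
    case 0
    then show ?case using q by (auto simp: path_between_def hd_conv_nth)
  next
    case (Suc i)
    then have "{q ! i, q ! Suc i} \<in> edges (path_graph 5)" using q by (auto simp: path_between_def)
    then show ?case using Suc unfolding edges_path_graph by auto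
  qed
  from this[of "gdist (path_graph 5) 0 4"] have "4 \<le> gdist (path_graph 5) 0 4"
    using q by (auto simp: path_between_def last_conv_nth)
  moreover have "gdist (path_graph 5) 0 4 \<le> 4"
    using gdist_le[OF path_graph_path[of 0 4 5]] by simp
  ultimately show ?thesis using diam_eq_4[OF P5_in_class] V by auto
qed

lemma d_max_eq_4: "d_max connected_P4_P1_free = 4"
  unfolding d_max_def
proof (rule antisym)
  show "(SUP G\<in>connected_P4_P1_free. diam G) \<le> 4" using diam_le_4 by (intro SUP_least)
  show "4 \<le> (SUP G\<in>connected_P4_P1_free. diam G)"
    using P5_in_class diam_P5 by (metis SUP_upper)
qed

section \<open>Running time of structured programs\<close>

text \<open>Total correctness with a time bound: existence of an execution includes halting and
  never leaving the word size. As \<open>T\<close> is only an upper bound, costs may be rounded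
  up.\<close>

definition runs :: "nat \<Rightarrow> com \<Rightarrow> state \<Rightarrow> nat \<Rightarrow> (state \<Rightarrow> bool) \<Rightarrow> bool" where
  "runs B c s T Q \<longleftrightarrow> (\<exists>t s'. exec B c s t s' \<and> t \<le> T \<and> Q s')"

lemma set_reg_simps [simp]:
  "reg (set_reg r x s) q = (if q = r then x else reg s q)"
  "arr (set_reg r x s) = arr s"
  by (simp_all add: set_reg_def)

lemma set_arr_simps [simp]:
  "reg (set_arr a i x s) = reg s"
  "arr (set_arr a i x s) b j = (if b = a \<and> j = i then x else arr s b j)"
  by (simp_all add: set_arr_def)

lemma runs_mono: "runs B c s T Q \<Longrightarrow> T \<le> T' \<Longrightarrow> (\<And>s'. Q s' \<Longrightarrow> Q' s') \<Longrightarrow> runs B c s T' Q'"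
  unfolding runs_def by (meson le_trans)

lemma runs_Skip: "1 \<le> T \<Longrightarrow> Q s \<Longrightarrow> runs B Skip s T Q"
  unfolding runs_def using exec.Skip by blast

lemma runs_SetReg:
  "afits B s e \<Longrightarrow> acost e + 1 \<le> T \<Longrightarrow> Q (set_reg r (aval s e) s) \<Longrightarrow> runs B (SetReg r e) s T Q"
  unfolding runs_def using exec.SetReg by blast

lemma runs_Write:
  "afits B s e \<Longrightarrow> afits B s f \<Longrightarrow> acost e + acost f + 1 \<le> T \<Longrightarrow>
   Q (set_arr a (aval s e) (aval s f) s) \<Longrightarrow> runs B (Write a e f) s T Q"
  unfolding runs_def using exec.Write by blast

lemma runs_Seq:
  assumes "runs B c s T R" "\<And>s'. R s' \<Longrightarrow> runs B d s' U Q" "T + U \<le> W"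
  shows "runs B (Seq c d) s W Q"
proof -
  obtain t s' where 1: "exec B c s t s'" "t \<le> T" "R s'" using assms(1) runs_def by auto
  obtain u s'' where 2: "exec B d s' u s''" "u \<le> U" "Q s''"
    using assms(2)[OF 1(3)] runs_def by auto
  have "t + u \<le> W" using 1 2 assms(3) by linarith
  then show ?thesis unfolding runs_def using exec.Seq[OF 1(1) 2(1)] 2(3) by blast
qed

lemma runs_If:
  assumes "bfits B s b" "bval s b \<Longrightarrow> runs B c s T Q" "\<not> bval s b \<Longrightarrow> runs B d s T Q"
    "bcost b + T + 1 \<le> U"
  shows "runs B (If b c d) s U Q"
proof (cases "bval s b")
  case True
  then obtain t s' where 1: "exec B c s t s'" "t \<le> T" "Q s'" using assms(2) runs_def by auto
  have "bcost b + t + 1 \<le> U" using 1 assms(4) by linarith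
  then show ?thesis unfolding runs_def using exec.IfTrue[OF assms(1) True 1(1)] 1(3) by blast
next
  case False
  then obtain t s' where 1: "exec B d s t s'" "t \<le> T" "Q s'" using assms(3) runs_def by auto
  have "bcost b + t + 1 \<le> U" using 1 assms(4) by linarith
  then show ?thesis unfolding runs_def using exec.IfFalse[OF assms(1) False 1(1)] 1(3) by blast
qed

definition For :: "nat \<Rightarrow> aexp \<Rightarrow> aexp \<Rightarrow> com \<Rightarrow> com" where
  "For r lo hi c = Seq (SetReg r lo)
     (While (Less (Reg r) hi) (Seq c (SetReg r (Plus (Reg r) (Const 1)))))"

text \<open>The invariant must fix the value of \<open>hi\<close>, which is evaluated afresh in
  every test. A round costs \<open>acost hi + 3\<close> for the test and 4 for the increment,
  besides the body; initialisation costs \<open>acost lo + 1\<close> and the failing test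
  \<open>acost hi + 3\<close>.\<close>

lemma runs_For:
  assumes lo: "afits B s lo" "aval s lo = l" and lh: "l \<le> h" "h < B"
    and init: "I l (set_reg r l s)"
    and hi: "\<And>i s. I i s \<Longrightarrow> reg s r = i \<and> afits B s hi \<and> aval s hi = h"
    and step: "\<And>i s. l \<le> i \<Longrightarrow> i < h \<Longrightarrow> I i s \<Longrightarrow>
      runs B c s (T i) (\<lambda>s. reg s r = i \<and> I (Suc i) (set_reg r (Suc i) s))"
    and time: "acost lo + acost hi + 4 + (\<Sum>i=l..<h. T i + acost hi + 7) \<le> U"
  shows "runs B (For r lo hi c) s U (I h)"
proof -
  let ?w = "While (Less (Reg r) hi) (Seq c (SetReg r (Plus (Reg r) (Const 1))))"
  have loop: "runs B ?w s (acost hi + 3 + (\<Sum>i=i..<h. T i + acost hi + 7)) (I h)"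
    if "l \<le> i" "i \<le> h" "I i s" for i s
    using that
  proof (induction "h - i" arbitrary: i s)
    case 0
    then have i: "i = h" by simp
    have "exec B ?w s (bcost (Less (Reg r) hi) + 1) s"
      using hi[OF 0(4)] lh i by (intro exec.WhileFalse) auto
    then show ?case unfolding runs_def using i 0 by fastforce
  next
    case (Suc k)
    then have i: "i < h" by simp
    obtain t s' where 1: "exec B c s t s'" "t \<le> T i" "reg s' r = i" "I (Suc i) (set_reg r (Suc i) s')"
      using step[OF Suc.prems(1) i Suc.prems(3)] unfolding runs_def by auto
    have "exec B (SetReg r (Plus (Reg r) (Const 1))) s' 4 (set_reg r (Suc i) s')"
      using exec.SetReg[of B s' "Plus (Reg r) (Const 1)" r] 1 i lh by (simp add: eval_nat_numeral)
    then have 2: "exec B (Seq c (SetReg r (Plus (Reg r) (Const 1)))) s (t + 4) (set_reg r (Suc i) s')"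
      using exec.Seq 1 by blast
    obtain u s'' where 3: "exec B ?w (set_reg r (Suc i) s') u s''"
      "u \<le> acost hi + 3 + (\<Sum>i=Suc i..<h. T i + acost hi + 7)" "I h s''"
      using Suc.hyps(1)[OF _ _ _ 1(4)] Suc.hyps(2) Suc.prems(1) i unfolding runs_def by fastforce
    have "exec B ?w s (bcost (Less (Reg r) hi) + (t + 4) + u + 1) s''"
      using hi[OF Suc.prems(3)] lh i by (intro exec.WhileTrue[OF _ _ 2 3(1)]) auto
    moreover have "bcost (Less (Reg r) hi) + (t + 4) + u + 1
        \<le> acost hi + 3 + (\<Sum>i=i..<h. T i + acost hi + 7)"
      using 1(2) 3(2) i by (simp add: sum.atLeast_Suc_lessThan)
    ultimately show ?case unfolding runs_def using 3(3) by blast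
  qed
  show ?thesis unfolding For_def
    by (rule runs_Seq[OF runs_SetReg[OF lo(1) order_refl, where Q = "I l"] loop])
      (use lh init lo(2) time in auto)
qed

section \<open>The program and its verification\<close>

text \<open>Register 1 holds the source of the current sweep, register 2 the layer, register 3 the
  eccentricity of the source plus one, registers 4 and 5 the loop indices, register 6 the
  number of neighbours in the previous layer and register 7 its minimum so far; array 2 holds the
  distances plus one.\<close>

definition vertex_loop :: "com \<Rightarrow> com" where
  "vertex_loop c = For 4 (Const 0) (Reg 0) c"

definition neighbour_loop :: "com \<Rightarrow> com" where
  "neighbour_loop c = For 5 (Read 0 (Reg 4)) (Read 0 (Plus (Reg 4) (Const 1))) c"

abbreviation nbr :: aexp where
  "nbr \<equiv> Read 1 (Reg 5)"

text \<open>Entries are distances plus one: in the pass for layer \<open>k\<close>, entry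
  \<open>k\<close> selects the vertices at distance \<open>k - 1\<close>, and their unvisited
  neighbours receive \<open>k + 1\<close>.\<close>

definition mark_pass :: com where
  "mark_pass = vertex_loop (If (Equal (Read 2 (Reg 4)) (Reg 2))
     (neighbour_loop (If (Equal (Read 2 nbr) (Const 0))
        (Seq (Write 2 nbr (Plus (Reg 2) (Const 1))) (SetReg 3 (Plus (Reg 2) (Const 1)))) Skip))
     Skip)"

text \<open>For eccentricity \<open>m\<close>, register 3 holds \<open>m + 1\<close>, so the test
  selects the neighbours with entry \<open>m\<close>, at distance \<open>m - 1\<close>.\<close>

definition count_back :: com where
  "count_back = neighbour_loop (If (Equal (Plus (Read 2 nbr) (Const 1)) (Reg 3))
     (SetReg 6 (Plus (Reg 6) (Const 1))) Skip)"

text \<open>The initial minimum \<open>n + 1\<close> exceeds every back degree, so the first vertex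
  of the last layer is always accepted.\<close>

definition select_next :: com where
  "select_next = Seq (SetReg 7 (Plus (Reg 0) (Const 1)))
     (vertex_loop (If (Equal (Read 2 (Reg 4)) (Reg 3))
       (Seq (SetReg 6 (Const 0)) (Seq count_back
         (If (Less (Reg 6) (Reg 7)) (Seq (SetReg 7 (Reg 6)) (SetReg 1 (Reg 4))) Skip)))
       Skip))"

definition sweep :: com where
  "sweep = Seq (vertex_loop (Write 2 (Reg 4) (Const 0)))
     (Seq (Write 2 (Reg 1) (Const 1)) (Seq (SetReg 3 (Const 1))
       (Seq (For 2 (Const 1) (Const 5) mark_pass) select_next)))"

text \<open>The first two sweeps move register 1 to a pick from a pick; the third measures the
  eccentricity of that vertex, and 5 in register 3 means eccentricity 4.\<close>

definition diam4_program :: com where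
  "diam4_program = Seq sweep (Seq sweep (Seq sweep
     (If (Equal (Reg 3) (Const 5)) (SetReg 0 (Const 1)) (SetReg 0 (Const 0)))))"

text \<open>The bound \<open>n + 6 < B\<close> covers counters up to \<open>n + 1\<close> and
  entries up to 5 with one added; the other bound covers positions in array 1.\<close>

locale diam4_input = P4_P1_free_metric "{..<n}" E d
  for n :: nat and E d +
  fixes adj :: "nat list list" and B :: nat
  assumes length_adj: "length adj = n"
    and distinct_adj: "i < n \<Longrightarrow> distinct (adj ! i)"
    and set_adj: "i < n \<Longrightarrow> set (adj ! i) = {j. E i j}"
    and n_pos: "0 < n"
    and word: "n + 6 < B" "length (concat adj) < B"
begin

section \<open>Neighbourhoods as blocks of positions in array 1\<close>

definition off :: "nat \<Rightarrow> nat" where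
  "off i = length (concat (take i adj))"

abbreviation nb :: "nat \<Rightarrow> nat" where
  "nb p \<equiv> concat adj ! p"

lemma off_Suc: "i < n \<Longrightarrow> off (Suc i) = off i + length (adj ! i)"
  by (simp add: off_def length_adj take_Suc_conv_app_nth)

lemma off_n: "off n = length (concat adj)"
  by (simp add: off_def length_adj)

lemma off_mono: "i \<le> j \<Longrightarrow> off i \<le> off j"
proof -
  assume "i \<le> j"
  then have "take j adj = take i adj @ take (j - i) (drop i adj)"
    by (metis le_add_diff_inverse take_add)
  then show "off i \<le> off j" by (simp add: off_def)
qed

lemma off_le: "i \<le> n \<Longrightarrow> off i \<le> off n"
  by (rule off_mono)

lemma off_less_B: "i \<le> n \<Longrightarrow> off i < B"
  using off_le off_n word(2) by fastforce

lemma nb_off: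
  assumes "i < n" "j < length (adj ! i)"
  shows "nb (off i + j) = adj ! i ! j"
proof -
  have "concat adj = concat (take i adj) @ adj ! i @ concat (drop (Suc i) adj)"
    using assms(1) length_adj by (metis append.assoc concat.simps(2) concat_append id_take_nth_drop)
  then show ?thesis using assms by (simp add: off_def nth_append)
qed

text \<open>A loop over positions meets every neighbour exactly once; injectivity is what makes the
  counting of back neighbours correct.\<close>

lemma nb_bij:
  assumes "i < n"
  shows "bij_betw nb {off i..<off (Suc i)} {j. E i j}"
proof -
  have "bij_betw ((!) (adj ! i)) {..<length (adj ! i)} {j. E i j}"
    using bij_betw_nth[OF distinct_adj[OF assms]] set_adj[OF assms] by simp
  moreover have "bij_betw (\<lambda>p. p - off i) {off i..<off (Suc i)} {..<length (adj ! i)}"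
    using off_Suc[OF assms] by (intro bij_betw_byWitness[where f' = "\<lambda>j. off i + j"]) auto
  ultimately have "bij_betw ((!) (adj ! i) \<circ> (\<lambda>p. p - off i)) {off i..<off (Suc i)} {j. E i j}"
    using bij_betw_trans by blast
  moreover have "((!) (adj ! i) \<circ> (\<lambda>p. p - off i)) p = nb p" if "p \<in> {off i..<off (Suc i)}" for p
    using nb_off[of i "p - off i"] that assms off_Suc by auto
  ultimately show ?thesis by (subst (asm) bij_betw_cong)
qed

lemma nb_edge: "i < n \<Longrightarrow> off i \<le> p \<Longrightarrow> p < off (Suc i) \<Longrightarrow> E i (nb p)"
  using bij_betw_apply[OF nb_bij] by fastforce

lemma nb_image: "i < n \<Longrightarrow> nb ` {off i..<off (Suc i)} = {j. E i j}"
  using nb_bij by (simp add: bij_betw_def)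

definition inp :: "state \<Rightarrow> bool" where
  "inp s \<longleftrightarrow> reg s 0 = n \<and> (\<forall>i \<le> n. arr s 0 i = off i) \<and> (\<forall>p < off n. arr s 1 p = nb p)"

lemma inp_set [simp]:
  "r \<noteq> 0 \<Longrightarrow> inp (set_reg r x s) = inp s"
  "1 < a \<Longrightarrow> inp (set_arr a i x s) = inp s"
  by (auto simp: inp_def)

text \<open>Source of the linear time bound: a body whose cost is affine in the degree sums to a
  multiple of \<open>n\<close> plus a multiple of \<open>off n\<close>, the total length of the
  lists.\<close>

lemma runs_vertex_loop:
  assumes "inp s" "I 0 (set_reg 4 0 s)"
    and hi: "\<And>i s. I i s \<Longrightarrow> inp s \<and> reg s 4 = i"
    and step: "\<And>i s. i < n \<Longrightarrow> I i s \<Longrightarrow>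
      runs B c s (a + b * length (adj ! i)) (\<lambda>s. reg s 4 = i \<and> I (Suc i) (set_reg 4 (Suc i) s))"
    and "6 + (a + 8) * n + b * off n \<le> U"
  shows "runs B (vertex_loop c) s U (I n)"
  unfolding vertex_loop_def
proof (rule runs_For)
  have "(\<Sum>i=0..<j. length (adj ! i)) = off j" if "j \<le> n" for j
    using that by (induction j) (auto simp: off_Suc, simp add: off_def)
  then have "(\<Sum>i = 0..<n. a + b * length (adj ! i) + acost (Reg 0) + 7) = (a + 8) * n + b * off n"
    by (simp add: sum.distrib algebra_simps flip: sum_distrib_left)
  then show "acost (Const 0) + acost (Reg 0) + 4 +
    (\<Sum>i = 0..<n. a + b * length (adj ! i) + acost (Reg 0) + 7) \<le> U"
    using assms(5) by simp
  show "runs B c s (a + b * length (adj ! i)) (\<lambda>s. reg s 4 = i \<and> I (Suc i) (set_reg 4 (Suc i) s))"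
    if "i < n" "I i s" for i s using step that .
  show "reg s 4 = i \<and> afits B s (Reg 0) \<and> aval s (Reg 0) = n" if "I i s" for i s
    using hi[OF that] word by (auto simp: inp_def)
qed (use assms word in auto)

lemma runs_neighbour_loop:
  assumes s: "inp s" "reg s 4 = u" "u < n" "I (off u) (set_reg 5 (off u) s)"
    and hi: "\<And>p s. I p s \<Longrightarrow> inp s \<and> reg s 4 = u \<and> reg s 5 = p"
    and step: "\<And>p s. off u \<le> p \<Longrightarrow> p < off (Suc u) \<Longrightarrow> E u (nb p) \<Longrightarrow> nb p < n \<Longrightarrow> p < B \<Longrightarrow>
      I p s \<Longrightarrow> arr s 1 p = nb p \<Longrightarrow>
      runs B c s t (\<lambda>s. reg s 5 = p \<and> I (Suc p) (set_reg 5 (Suc p) s))"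
    and "10 + (t + 11) * length (adj ! u) \<le> U"
  shows "runs B (neighbour_loop c) s U (I (off (Suc u)))"
  unfolding neighbour_loop_def
proof (rule runs_For)
  show "off u \<le> off (Suc u)" "off (Suc u) < B"
    using s off_Suc off_less_B[of "Suc u"] by auto
  show "afits B s (Read 0 (Reg 4))" "aval s (Read 0 (Reg 4)) = off u"
    using s off_less_B[of u] word by (auto simp: inp_def)
  show "runs B c s t (\<lambda>s. reg s 5 = p \<and> I (Suc p) (set_reg 5 (Suc p) s))"
    if p: "off u \<le> p" "p < off (Suc u)" "I p s" for p s
  proof (rule step[OF p(1,2) _ _ _ p(3)])
    show "E u (nb p)" using nb_edge s(3) p by blast
    then show "nb p < n" using E_V by blast
    have "p < off n" using p(2) off_le[of "Suc u"] s(3) by simp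
    then show "arr s 1 p = nb p" "p < B" using hi[OF p(3)] off_less_B[of n] by (auto simp: inp_def)
  qed
  show "acost (Read 0 (Reg 4)) + acost (Read 0 (Plus (Reg 4) (Const 1))) + 4 +
    (\<Sum>i = off u..<off (Suc u). t + acost (Read 0 (Plus (Reg 4) (Const 1))) + 7) \<le> U"
    using assms(7) off_Suc[OF s(3)] by (simp add: algebra_simps)
  show "reg s' 5 = p \<and> afits B s' (Read 0 (Plus (Reg 4) (Const 1))) \<and>
      aval s' (Read 0 (Plus (Reg 4) (Const 1))) = off (Suc u)" if "I p s'" for p s'
    using hi[OF that] s(3) word off_less_B[of "Suc u"] by (auto simp: inp_def)
qed (use s in auto)

text \<open>During the pass for layer \<open>k\<close>, exactly the vertices of \<open>Z\<close> at distance \<open>k\<close> have been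
  marked. An entry 0 of array 2 means unvisited.\<close>

definition marked :: "nat \<Rightarrow> nat \<Rightarrow> nat set \<Rightarrow> state \<Rightarrow> bool" where
  "marked x k Z s \<longleftrightarrow> inp s \<and> reg s 1 = x \<and> reg s 2 = k \<and>
     (\<forall>i < n. arr s 2 i = (if d x i < k \<or> (d x i = k \<and> i \<in> Z) then Suc (d x i) else 0)) \<and>
     (\<forall>i < n. arr s 2 i \<le> reg s 3) \<and> (\<exists>i < n. Suc (d x i) = reg s 3)"

lemma marked_set_reg [simp]:
  "3 < r \<Longrightarrow> marked x k Z (set_reg r y s) = marked x k Z s"
  by (auto simp: marked_def)

lemma marked_mark:
  assumes "marked x k Z s" "v < n" "d x v = k"
  shows "marked x k (insert v Z) (set_reg 3 (Suc k) (set_arr 2 v (Suc k) s))"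
  using assms unfolding marked_def by auto

lemma marked_old:
  assumes "marked x k Z s" "v < n" "arr s 2 v \<noteq> 0"
  shows "marked x k (insert v Z) s"
proof -
  have "d x v < k \<or> d x v = k \<and> v \<in> Z" using assms by (auto simp: marked_def split: if_splits)
  then have *: "(d x i < k \<or> d x i = k \<and> i \<in> insert v Z) = (d x i < k \<or> d x i = k \<and> i \<in> Z)" for i
    by auto
  then show ?thesis using assms(1) unfolding marked_def * by blast
qed

lemma runs_mark_pass:
  assumes x: "x < n" and k: "0 < k" "k < 5" and s: "marked x k {} s"
  shows "runs B mark_pass s (6 + 23 * n + 27 * off n)
    (\<lambda>s. reg s 2 = k \<and> marked x (Suc k) {} (set_reg 2 (Suc k) s))"
proof -
  \<comment> \<open>The vertices reached from layer \<open>k - 1\<close> once the outer loop has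
    treated all vertices below \<open>u\<close>.\<close>
  define Z where "Z u = {j. \<exists>w < u. Suc (d x w) = k \<and> E w j}" for u
  have "runs B mark_pass s (6 + 23 * n + 27 * off n) (\<lambda>s. marked x k (Z n) s \<and> reg s 4 = n)"
    unfolding mark_pass_def
  proof (rule runs_vertex_loop[where a = 15 and b = 27
        and I = "\<lambda>u s. marked x k (Z u) s \<and> reg s 4 = u"])
    show "inp s" using s marked_def by blast
    show "marked x k (Z 0) (set_reg 4 0 s) \<and> reg (set_reg 4 0 s) 4 = 0"
      using s by (simp add: Z_def)
    fix u s assume u: "u < n" and s: "marked x k (Z u) s \<and> reg s 4 = u"
    let ?Z = "\<lambda>p. Z u \<union> nb ` {off u..<p}"
    have au: "arr s 2 u = (if d x u < k \<or> (d x u = k \<and> u \<in> Z u) then Suc (d x u) else 0)"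
      using s u by (simp add: marked_def)
    have r2: "reg s 2 = k" using s by (simp add: marked_def)
    show "runs B (If (Equal (Read 2 (Reg 4)) (Reg 2))
         (neighbour_loop (If (Equal (Read 2 nbr) (Const 0))
           (Seq (Write 2 nbr (Plus (Reg 2) (Const 1))) (SetReg 3 (Plus (Reg 2) (Const 1)))) Skip))
         Skip) s (15 + 27 * length (adj ! u))
       (\<lambda>s. reg s 4 = u \<and> marked x k (Z (Suc u)) (set_reg 4 (Suc u) s) \<and>
            reg (set_reg 4 (Suc u) s) 4 = Suc u)"
    proof (rule runs_If[where T = "10 + 27 * length (adj ! u)"])
      show "bfits B s (Equal (Read 2 (Reg 4)) (Reg 2))"
        using au r2 k u word s by auto
    next
      assume "\<not> bval s (Equal (Read 2 (Reg 4)) (Reg 2))"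
      then have "Suc (d x u) \<noteq> k" using au r2 s by (auto split: if_splits)
      then have "Z (Suc u) = Z u" by (auto simp: Z_def less_Suc_eq)
      then show "runs B Skip s (10 + 27 * length (adj ! u)) (\<lambda>s. reg s 4 = u \<and>
         marked x k (Z (Suc u)) (set_reg 4 (Suc u) s) \<and> reg (set_reg 4 (Suc u) s) 4 = Suc u)"
        using s by (intro runs_Skip) auto
    next
      assume "bval s (Equal (Read 2 (Reg 4)) (Reg 2))"
      \<comment> \<open>Unvisited vertices have entry 0, which differs from the positive
        \<open>k\<close>, and vertices marked in this pass have entry \<open>k + 1\<close>.\<close>
      then have du: "Suc (d x u) = k" using au r2 s k by (auto split: if_splits)
      have "Z (Suc u) = ?Z (off (Suc u))"
        using nb_image[OF u] du by (auto simp: Z_def less_Suc_eq)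
      moreover have "runs B (neighbour_loop (If (Equal (Read 2 nbr) (Const 0))
           (Seq (Write 2 nbr (Plus (Reg 2) (Const 1))) (SetReg 3 (Plus (Reg 2) (Const 1)))) Skip)) s
         (10 + 27 * length (adj ! u))
         (\<lambda>s. marked x k (?Z (off (Suc u))) s \<and> reg s 4 = u \<and> reg s 5 = off (Suc u))"
      proof (rule runs_neighbour_loop[where t = 16
            and I = "\<lambda>p s. marked x k (?Z p) s \<and> reg s 4 = u \<and> reg s 5 = p"])
        fix p s assume p: "off u \<le> p" "p < off (Suc u)" "E u (nb p)" "nb p < n" "p < B"
          and s: "marked x k (?Z p) s \<and> reg s 4 = u \<and> reg s 5 = p" and ap: "arr s 1 p = nb p"
        have Zp: "?Z (Suc p) = insert (nb p) (?Z p)"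
          using p by (auto simp: atLeastLessThanSuc)
        have av: "arr s 2 (nb p) = (if d x (nb p) < k \<or> (d x (nb p) = k \<and> nb p \<in> ?Z p)
            then Suc (d x (nb p)) else 0)"
          using s p by (simp add: marked_def)
        have r2: "reg s 2 = k" using s by (simp add: marked_def)
        have dv: "d x (nb p) \<le> k" using d_edge[of x u "nb p"] x p du by simp
        show "runs B (If (Equal (Read 2 nbr) (Const 0))
           (Seq (Write 2 nbr (Plus (Reg 2) (Const 1))) (SetReg 3 (Plus (Reg 2) (Const 1)))) Skip) s 16
          (\<lambda>s. reg s 5 = p \<and> marked x k (?Z (Suc p)) (set_reg 5 (Suc p) s) \<and>
            reg (set_reg 5 (Suc p) s) 4 = u \<and> reg (set_reg 5 (Suc p) s) 5 = Suc p)"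
        proof (rule runs_If[where T = 10])
          show "bfits B s (Equal (Read 2 nbr) (Const 0))"
            using av dv s ap p word k by auto
        next
          assume "\<not> bval s (Equal (Read 2 nbr) (Const 0))"
          then have "arr s 2 (nb p) \<noteq> 0" using s ap by simp
          then have "marked x k (?Z (Suc p)) s" using marked_old s p unfolding Zp by blast
          then show "runs B Skip s 10 (\<lambda>s. reg s 5 = p \<and> marked x k (?Z (Suc p)) (set_reg 5 (Suc p) s) \<and>
            reg (set_reg 5 (Suc p) s) 4 = u \<and> reg (set_reg 5 (Suc p) s) 5 = Suc p)"
            using s by (intro runs_Skip) auto
        next
          assume "bval s (Equal (Read 2 nbr) (Const 0))"
          then have "d x (nb p) = k" using av dv s ap by (auto split: if_splits)
          then have m: "marked x k (?Z (Suc p)) (set_reg 3 (Suc k) (set_arr 2 (nb p) (Suc k) s))"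
            using marked_mark[of x k "?Z p" s "nb p"] s p unfolding Zp by blast
          show "runs B (Seq (Write 2 nbr (Plus (Reg 2) (Const 1))) (SetReg 3 (Plus (Reg 2) (Const 1)))) s 10
            (\<lambda>s. reg s 5 = p \<and> marked x k (?Z (Suc p)) (set_reg 5 (Suc p) s) \<and>
              reg (set_reg 5 (Suc p) s) 4 = u \<and> reg (set_reg 5 (Suc p) s) 5 = Suc p)"
            by (rule runs_Seq[OF runs_Write[where T = 6 and Q = "\<lambda>s'. s' = set_arr 2 (nb p) (Suc k) s"]
                  runs_SetReg[where T = 4]])
              (use s ap p k word r2 m in auto)
        qed simp
      qed (use s u in \<open>auto simp: marked_def\<close>)
      ultimately show "runs B (neighbour_loop (If (Equal (Read 2 nbr) (Const 0))
           (Seq (Write 2 nbr (Plus (Reg 2) (Const 1))) (SetReg 3 (Plus (Reg 2) (Const 1)))) Skip)) s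
         (10 + 27 * length (adj ! u)) (\<lambda>s. reg s 4 = u \<and>
         marked x k (Z (Suc u)) (set_reg 4 (Suc u) s) \<and> reg (set_reg 4 (Suc u) s) 4 = Suc u)"
        by (elim runs_mono) auto
    qed simp
  qed (auto simp: marked_def)
  moreover have "reg s 2 = k \<and> marked x (Suc k) {} (set_reg 2 (Suc k) s)" if "marked x k (Z n) s" for s
  proof -
    \<comment> \<open>A predecessor in layer \<open>k - 1\<close> exists, so the finished pass has
      marked all of layer \<open>k\<close>.\<close>
    have "i \<in> Z n" if "i < n" "d x i = k" for i
      using d_pred[of x i "k - 1"] x that k E_V unfolding Z_def by fastforce
    then show ?thesis using that unfolding marked_def by (auto simp: less_Suc_eq)
  qed
  ultimately show ?thesis by (elim runs_mono) auto
qed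

section \<open>Back degrees and the choice of a pick\<close>

definition measured :: "nat \<Rightarrow> nat \<Rightarrow> state \<Rightarrow> bool" where
  "measured x m s \<longleftrightarrow> inp s \<and> reg s 3 = Suc m \<and> (\<forall>i < n. arr s 2 i = Suc (d x i)) \<and>
     (\<forall>i < n. d x i \<le> m) \<and> (\<exists>i < n. d x i = m)"

lemma measured_set_reg [simp]:
  "r \<noteq> 0 \<Longrightarrow> r \<noteq> 3 \<Longrightarrow> measured x m (set_reg r y s) = measured x m s"
  by (auto simp: measured_def)

lemma measured_eq_5:
  assumes "measured x m s" "x < n"
  shows "reg s 3 \<le> 5 \<and> (reg s 3 = 5 \<longleftrightarrow> (\<exists>y < n. d x y = 4))"
proof -
  have m: "m \<le> 4" using assms dist_le_4 unfolding measured_def by fastforce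
  have le: "d x y \<le> m" if "y < n" for y using assms(1) that by (simp add: measured_def)
  have "reg s 3 = Suc m" "\<exists>y < n. d x y = m" using assms by (auto simp: measured_def)
  moreover from this(2) have "m = 4 \<longleftrightarrow> (\<exists>y < n. d x y = 4)" using m le order_antisym by metis
  ultimately show ?thesis using m by simp
qed

lemma degree_le: "card {z. E u z \<and> P z} \<le> n"
proof -
  have "{z. E u z \<and> P z} \<subseteq> {..<n}" using E_V by blast
  then show ?thesis using card_mono[of "{..<n}"] by fastforce
qed

lemma runs_count_back:
  assumes x: "x < n" and u: "u < n" "d x u = m" and s: "measured x m s" "reg s 4 = u" "reg s 6 = 0"
    "reg s 1 = y" "reg s 7 = b"
  shows "runs B count_back s (10 + 26 * length (adj ! u)) (\<lambda>s. measured x m s \<and> reg s 4 = u \<and>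
    reg s 6 = back_degree x u \<and> reg s 1 = y \<and> reg s 7 = b)"
proof -
  let ?C = "\<lambda>p. {z \<in> nb ` {off u..<p}. Suc (d x z) = m}"
  let ?I = "\<lambda>p s. measured x m s \<and> reg s 4 = u \<and> reg s 6 = card (?C p) \<and>
    reg s 1 = y \<and> reg s 7 = b \<and> reg s 5 = p"
  have "runs B count_back s (10 + 26 * length (adj ! u)) (?I (off (Suc u)))"
    unfolding count_back_def
  proof (rule runs_neighbour_loop[where t = 15 and I = ?I])
    fix p s assume p: "off u \<le> p" "p < off (Suc u)" "E u (nb p)" "nb p < n" "p < B"
      and s: "?I p s" and ap: "arr s 1 p = nb p"
    have av: "arr s 2 (nb p) = Suc (d x (nb p))" "reg s 3 = Suc m"
      using s p by (simp_all add: measured_def)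
    have "nb p \<notin> nb ` {off u..<p}"
    proof
      assume "nb p \<in> nb ` {off u..<p}"
      then obtain q where q: "q \<in> {off u..<p}" "nb q = nb p" by auto
      then show False using nb_bij[OF u(1)] p unfolding bij_betw_def inj_on_def by fastforce
    qed
    moreover have "nb ` {off u..<Suc p} = insert (nb p) (nb ` {off u..<p})"
      using p by (auto simp: atLeastLessThanSuc)
    then have "?C (Suc p) = (if Suc (d x (nb p)) = m then insert (nb p) (?C p) else ?C p)" by auto
    ultimately have C: "card (?C (Suc p)) = card (?C p) + (if Suc (d x (nb p)) = m then 1 else 0)"
      by simp
    have "?C p \<subseteq> {..<n}" using nb_edge[OF u(1)] p E_V by fastforce
    then have Cn: "card (?C p) \<le> n" using card_mono[of "{..<n}"] by fastforce
    have m4: "m < 5" "d x (nb p) < 5"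
      using dist_le_4[of x u] dist_le_4[of x "nb p"] x u p by auto
    show "runs B (If (Equal (Plus (Read 2 nbr) (Const 1)) (Reg 3))
       (SetReg 6 (Plus (Reg 6) (Const 1))) Skip) s 15
      (\<lambda>s. reg s 5 = p \<and> ?I (Suc p) (set_reg 5 (Suc p) s))"
    proof (rule runs_If[where T = 4])
      show "bfits B s (Equal (Plus (Read 2 nbr) (Const 1)) (Reg 3))"
        using av m4 s ap p word by auto
    next
      assume "bval s (Equal (Plus (Read 2 nbr) (Const 1)) (Reg 3))"
      then show "runs B (SetReg 6 (Plus (Reg 6) (Const 1))) s 4
        (\<lambda>s. reg s 5 = p \<and> ?I (Suc p) (set_reg 5 (Suc p) s))"
        using av s ap word Cn C by (intro runs_SetReg) auto
    next
      assume "\<not> bval s (Equal (Plus (Read 2 nbr) (Const 1)) (Reg 3))"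
      then show "runs B Skip s 4 (\<lambda>s. reg s 5 = p \<and> ?I (Suc p) (set_reg 5 (Suc p) s))"
        using av s ap C by (intro runs_Skip) auto
    qed simp
  qed (use s u in \<open>auto simp: measured_def\<close>)
  moreover have "card (?C (off (Suc u))) = back_degree x u"
    unfolding nb_image[OF u(1)] back_degree_def using u(2) by simp
  ultimately show ?thesis by (elim runs_mono) auto
qed

lemma runs_select_next:
  assumes x: "x < n" and s: "measured x m s" "reg s 1 = x"
  shows "runs B select_next s (10 + 41 * n + 26 * off n)
    (\<lambda>s. measured x m s \<and> reg s 1 < n \<and> pick x (reg s 1))"
proof -
  have m4: "m < 5" using s(1) x dist_le_4 unfolding measured_def by fastforce
  \<comment> \<open>Either no vertex of the last layer has been met and \<open>b\<close> is still
    the initial value, or \<open>y\<close> is a minimiser among those met.\<close>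
  let ?J = "\<lambda>u y b. y < n \<and> b \<le> Suc n \<and> (b = Suc n \<and> (\<forall>w < u. d x w \<noteq> m) \<or>
    d x y = m \<and> back_degree x y = b \<and> (\<forall>w < u. d x w = m \<longrightarrow> b \<le> back_degree x w))"
  let ?I = "\<lambda>u s. measured x m s \<and> reg s 4 = u \<and> ?J u (reg s 1) (reg s 7)"
  let ?c = "If (Less (Reg 6) (Reg 7)) (Seq (SetReg 7 (Reg 6)) (SetReg 1 (Reg 4))) Skip"
  have bd: "back_degree x u \<le> n" for u unfolding back_degree_def by (rule degree_le)
  have "runs B select_next s (10 + 41 * n + 26 * off n) (?I n)"
    unfolding select_next_def
  proof (rule runs_Seq[OF runs_SetReg[where T = 4 and Q = "\<lambda>s'. s' = set_reg 7 (Suc n) s"]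
        runs_vertex_loop[where a = 33 and b = 26 and I = ?I]])
    fix u s assume u: "u < n" and s: "?I u s"
    let ?Q = "\<lambda>s. reg s 4 = u \<and> ?I (Suc u) (set_reg 4 (Suc u) s)"
    have au: "arr s 2 u = Suc (d x u)" "reg s 3 = Suc m" "d x u \<le> m"
      using s u by (simp_all add: measured_def)
    show "runs B (If (Equal (Read 2 (Reg 4)) (Reg 3))
       (Seq (SetReg 6 (Const 0)) (Seq count_back ?c)) Skip) s (33 + 26 * length (adj ! u)) ?Q"
    proof (rule runs_If[where T = "28 + 26 * length (adj ! u)"])
      show "bfits B s (Equal (Read 2 (Reg 4)) (Reg 3))"
        using au m4 s u word by auto
    next
      assume "\<not> bval s (Equal (Read 2 (Reg 4)) (Reg 3))"
      then have "d x u \<noteq> m" using au s by auto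
      then show "runs B Skip s (28 + 26 * length (adj ! u)) ?Q"
        using s by (intro runs_Skip) (auto simp: less_Suc_eq)
    next
      assume "bval s (Equal (Read 2 (Reg 4)) (Reg 3))"
      then have du: "d x u = m" using au s by auto
      show "runs B (Seq (SetReg 6 (Const 0)) (Seq count_back ?c)) s (28 + 26 * length (adj ! u)) ?Q"
      proof (rule runs_Seq[OF runs_SetReg[where T = 2 and Q = "\<lambda>s'. s' = set_reg 6 0 s"]
            runs_Seq[OF runs_count_back[OF x u du, where y = "reg s 1" and b = "reg s 7"]
              runs_If[where T = 4]]])
        fix s' assume s': "measured x m s' \<and> reg s' 4 = u \<and> reg s' 6 = back_degree x u \<and>
          reg s' 1 = reg s 1 \<and> reg s' 7 = reg s 7"
        show "bfits B s' (Less (Reg 6) (Reg 7))" using s' s bd[of u] word by auto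
        show "runs B (Seq (SetReg 7 (Reg 6)) (SetReg 1 (Reg 4))) s' 4 ?Q"
          if "bval s' (Less (Reg 6) (Reg 7))"
          by (rule runs_Seq[OF runs_SetReg[where T = 2 and Q = "\<lambda>t. t = set_reg 7 (back_degree x u) s'"]
                runs_SetReg[where T = 2]])
            (use that s s' du u bd[of u] word in \<open>auto simp: less_Suc_eq\<close>)
        show "runs B Skip s' 4 ?Q" if "\<not> bval s' (Less (Reg 6) (Reg 7))"
          using that s s' du bd[of u] by (intro runs_Skip) (auto simp: less_Suc_eq)
      qed (use s word in auto)
    qed simp
  qed (use s x word in \<open>auto simp: measured_def inp_def\<close>)
  \<comment> \<open>The last layer is nonempty by \<open>measured\<close>, which excludes the first
    alternative of \<open>?J\<close>.\<close>
  moreover have "reg s 1 < n \<and> pick x (reg s 1)" if "?I n s" for s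
    using that unfolding pick_def measured_def by fastforce
  ultimately show ?thesis by (elim runs_mono) auto
qed

lemma runs_sweep:
  assumes s: "inp s" "reg s 1 = x" "x < n"
  shows "runs B sweep s (1000 + 1000 * n + 1000 * off n)
    (\<lambda>s. inp s \<and> reg s 1 < n \<and> pick x (reg s 1) \<and> reg s 3 \<le> 5 \<and>
      (reg s 3 = 5 \<longleftrightarrow> (\<exists>y < n. d x y = 4)))"
  unfolding sweep_def
proof (rule runs_Seq[OF runs_vertex_loop[where a = 4 and b = 0 and
        I = "\<lambda>u s. inp s \<and> reg s 1 = x \<and> reg s 4 = u \<and> (\<forall>i < u. arr s 2 i = 0)"]])
  fix s assume s: "inp s \<and> reg s 1 = x \<and> reg s 4 = n \<and> (\<forall>i < n. arr s 2 i = 0)"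
  have x0: "d x i = 0 \<longleftrightarrow> i = x" if "i < n" for i
    using that \<open>x < n\<close> d_self d_0 by auto
  show "runs B (Seq (Write 2 (Reg 1) (Const 1)) (Seq (SetReg 3 (Const 1))
       (Seq (For 2 (Const 1) (Const 5) mark_pass) select_next))) s (500 + 500 * n + 500 * off n)
    (\<lambda>s. inp s \<and> reg s 1 < n \<and> pick x (reg s 1) \<and> reg s 3 \<le> 5 \<and>
      (reg s 3 = 5 \<longleftrightarrow> (\<exists>y < n. d x y = 4)))"
  proof (rule runs_Seq[OF runs_Write[where T = 3 and Q = "\<lambda>s'. s' = set_arr 2 x 1 s"]
        runs_Seq[OF runs_SetReg[where T = 2 and Q = "\<lambda>s'. s' = set_reg 3 1 (set_arr 2 x 1 s)"]
          runs_Seq[OF runs_For[where T = "\<lambda>_. 6 + 23 * n + 27 * off n"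
              and I = "\<lambda>k s. marked x k {} s"]]]])
    \<comment> \<open>All distances are below 5, so after the passes for layers 1 to 4 no vertex is
      unvisited and register 3 is the eccentricity plus one.\<close>
    fix s assume "marked x 5 {} s"
    moreover have "d x i < 5" if "i < n" for i using dist_le_4 \<open>x < n\<close> that by fastforce
    ultimately have m: "measured x (reg s 3 - 1) s" "reg s 1 = x"
      unfolding marked_def measured_def by fastforce+
    have "reg s' 3 \<le> 5 \<and> (reg s' 3 = 5 \<longleftrightarrow> (\<exists>y < n. d x y = 4))" if "measured x (reg s 3 - 1) s'" for s'
      using measured_eq_5[OF that \<open>x < n\<close>] .
    then show "runs B select_next s (10 + 41 * n + 26 * off n) (\<lambda>s. inp s \<and> reg s 1 < n \<and>
        pick x (reg s 1) \<and> reg s 3 \<le> 5 \<and>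
      (reg s 3 = 5 \<longleftrightarrow> (\<exists>y < n. d x y = 4)))"
      using runs_select_next[OF \<open>x < n\<close> m] by (elim runs_mono) (auto simp: measured_def)
  next
    fix k s assume "1 \<le> k" "k < (5::nat)" "marked x k {} s"
    then show "runs B mark_pass s (6 + 23 * n + 27 * off n)
        (\<lambda>s. reg s 2 = k \<and> marked x (Suc k) {} (set_reg 2 (Suc k) s))"
      using runs_mark_pass \<open>x < n\<close> by simp
  qed (use s \<open>x < n\<close> word x0 in \<open>auto simp: marked_def\<close>)
qed (use s word in \<open>auto simp: less_Suc_eq inp_def intro!: runs_Write\<close>)

end

context diam4_input
begin

text \<open>A pair at distance 4, if there is one, serves as the antipodal pair for
  \<open>pick_pick\<close>; conversely \<open>z\<close> itself belongs to such a pair.\<close>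

lemma pick_pick_diam4:
  assumes "pick x y" "pick y z" "x < n"
  shows "(\<exists>w < n. d z w = 4) \<longleftrightarrow> (\<exists>i < n. \<exists>j < n. d i j = 4)"
proof
  assume "\<exists>i < n. \<exists>j < n. d i j = 4"
  then obtain i j where "i < n" "j < n" "d i j = 4" by blast
  then interpret antipodal_pair "{..<n}" E d i j by unfold_locales auto
  show "\<exists>w < n. d z w = 4" using pick_pick[OF _ assms(1,2)] assms(3) by auto
qed (use assms in \<open>auto simp: pick_def\<close>)

lemma runs_diam4_program:
  assumes s: "inp s" "reg s 1 = 0"
  shows "runs B diam4_program s (4000 + 3000 * n + 3000 * off n)
    (\<lambda>s. reg s 0 = (if \<exists>i < n. \<exists>j < n. d i j = 4 then 1 else 0))"
proof -
  let ?U = "\<lambda>c. c * (1000 + 1000 * n + 1000 * off n)"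
  let ?test = "If (Equal (Reg 3) (Const 5)) (SetReg 0 (Const 1)) (SetReg 0 (Const 0))"
  let ?Q = "\<lambda>s. reg s 0 = (if \<exists>i < n. \<exists>j < n. d i j = 4 then 1 else 0)"
  \<comment> \<open>The program from the third sweep on: \<open>y\<close> is the first pick, and
    register 1 holds the second.\<close>
  have 3: "runs B (Seq sweep ?test) s (?U 1 + 7) ?Q"
    if "inp s" "reg s 1 < n" "pick 0 y" "pick y (reg s 1)" for s y
    by (rule runs_Seq[OF runs_sweep[OF that(1) refl that(2)] runs_If[where T = 2 and U = 7]])
      (use word pick_pick_diam4[OF that(3,4) n_pos] in \<open>auto intro!: runs_SetReg\<close>)
  have 2: "runs B (Seq sweep (Seq sweep ?test)) s (?U 2 + 7) ?Q"
    if "inp s" "reg s 1 < n" "pick 0 (reg s 1)" for s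
    by (rule runs_Seq[OF runs_sweep[OF that(1) refl that(2)] 3[OF _ _ that(3)]]) auto
  show ?thesis
    unfolding diam4_program_def by (rule runs_Seq[OF runs_sweep[OF s n_pos] 2]) auto
qed

lemma inp_input_state: "inp (input_state adj)" "reg (input_state adj) 1 = 0"
  by (auto simp: inp_def input_state_def off_def length_adj)

end

section \<open>Input length, word size and the final bound\<close>

lemma length_concat_adjacency:
  assumes "length adj = n" "\<And>i. i < n \<Longrightarrow> distinct (adj ! i)" "\<And>i. i < n \<Longrightarrow> set (adj ! i) = A i"
  shows "length (concat adj) = card (SIGMA i:{..<n}. A i)"
proof -
  have "length (concat adj) = (\<Sum>i<n. length (adj ! i))"
    by (simp add: length_concat sum_list_sum_nth assms(1) atLeast0LessThan)
  also have "\<dots> = (\<Sum>i<n. card (A i))"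
    using assms(2,3) by (intro sum.cong refl) (metis distinct_card lessThan_iff)
  also have "\<dots> = card (SIGMA i:{..<n}. A i)"
    using assms(3) by (subst card_SigmaI) (auto simp flip: assms(3))
  finally show ?thesis .
qed

theorem theorem13:
  "d_max connected_P4_P1_free = 4 \<and>
   (\<exists>c k C. decides_in_time c k connected_P4_P1_free (\<lambda>G. diam G = 4)
      (\<lambda>G. C * (card (verts G) + card (edges G))))"
proof (intro conjI exI)
  show "d_max connected_P4_P1_free = 4" by (rule d_max_eq_4)
  \<comment> \<open>Exponent 4 suffices since \<open>(n + 1) ^ 4\<close> is at least
    \<open>4 * (n + 1) ^ 2\<close> for positive \<open>n\<close>, which exceeds both
    \<open>n + 6\<close> and \<open>n * n\<close>.\<close>
  show "decides_in_time diam4_program 4 connected_P4_P1_free (\<lambda>G. diam G = 4)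
    (\<lambda>G. 10000 * (card (verts G) + card (edges G)))"
    unfolding decides_in_time_def
  proof (intro ballI allI impI)
    fix G :: "nat graph" and vs adj
    assume G: "G \<in> connected_P4_P1_free" and adj: "adjacency_lists G vs adj"
    let ?n = "length vs" and ?B = "(card (verts G) + 1) ^ 4"
    let ?E = "\<lambda>i j. i \<in> {..<?n} \<and> j \<in> {..<?n} \<and> {vs ! i, vs ! j} \<in> edges G"
    let ?d = "\<lambda>i j. gdist G (vs ! i) (vs ! j)"
    have vs: "distinct vs" "set vs = verts G" using adj by (auto simp: adjacency_lists_def)
    then have n: "card (verts G) = ?n" using distinct_card by metis
    have bij: "bij_betw ((!) vs) {..<?n} (verts G)" using bij_betw_nth vs by blast
    interpret P4_P1_free_metric "{..<?n}" ?E ?d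
      using P4_P1_free_metric_reindex[OF P4_P1_free_metric_gdist[OF G] bij] .
    have adj': "length adj = ?n" "\<And>i. i < ?n \<Longrightarrow> distinct (adj ! i)" "\<And>i. i < ?n \<Longrightarrow> set (adj ! i) = {j. ?E i j}"
      using adj by (auto simp: adjacency_lists_def)
    have n0: "0 < ?n" using G vs by (auto simp: connected_P4_P1_free_def connected_graph_def)
    let ?S = "SIGMA i:{..<?n}. {j. ?E i j}"
    have N: "length (concat adj) = card ?S"
      using length_concat_adjacency[OF adj'] .
    have "card ?S \<le> card ({..<?n} \<times> {..<?n})" by (intro card_mono) auto
    then have N1: "length (concat adj) \<le> ?n * ?n" using N by simp
    have "finite (edges G)"
      using G finite_subset[of "edges G" "Pow (verts G)"]
      by (auto simp: connected_P4_P1_free_def simple_graph_def)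
    \<comment> \<open>Each edge yields two ordered pairs, told apart by the bit
      \<open>i < j\<close>; hence the lists have at most twice as many entries as there are
      edges.\<close>
    moreover have "inj_on (\<lambda>(i, j). ({vs ! i, vs ! j}, i < j)) ?S"
      using vs by (auto simp: inj_on_def doubleton_eq_iff nth_eq_iff_index_eq)
    ultimately have "card ?S \<le> card (edges G \<times> (UNIV :: bool set))"
      by (intro card_inj_on_le) auto
    then have N2: "length (concat adj) \<le> 2 * card (edges G)" using N by (simp add: card_cartesian_product)
    have "2 ^ 2 \<le> (?n + 1) ^ 2" using n0 by (intro power_mono; linarith)
    then have "(?n + 1) ^ 2 * 4 \<le> (?n + 1) ^ 2 * (?n + 1) ^ 2"
      by (intro mult_left_mono) auto
    then have B4: "(?n + 1) ^ 2 * 4 \<le> ?B" unfolding n by (simp flip: power_add)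
    moreover have "?n + 6 < (?n + 1) ^ 2 * 4" "?n * ?n < (?n + 1) ^ 2 * 4"
      using n0 by (cases ?n; simp add: power2_eq_square)+
    ultimately have word: "?n + 6 < ?B" "length (concat adj) < ?B" using N1 by linarith+
    interpret diam4_input ?n ?E ?d adj ?B
      by unfold_locales (use adj' n0 word in auto)
    have "(\<exists>i < ?n. \<exists>j < ?n. ?d i j = 4) \<longleftrightarrow> diam G = 4"
      unfolding diam_eq_4[OF G] by (simp flip: vs(2) add: set_conv_nth) blast
    then have "runs ?B diam4_program (input_state adj) (4000 + 3000 * ?n + 3000 * off ?n)
        (\<lambda>s. reg s 0 = (if diam G = 4 then 1 else 0))"
      using runs_diam4_program[OF inp_input_state] by simp
    \<comment> \<open>The constant term is absorbed because there is at least one vertex.\<close>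
    moreover have "4000 + 3000 * a + 3000 * b \<le> 10000 * (a + c)" if "0 < a" "b \<le> 2 * c" for a b c :: nat
      using that by (simp add: algebra_simps)
    then have "4000 + 3000 * ?n + 3000 * off ?n \<le> 10000 * (card (verts G) + card (edges G))"
      unfolding n off_n using N2 n0 by blast
    ultimately show "\<exists>t s. exec ?B diam4_program (input_state adj) t s \<and>
        t \<le> 10000 * (card (verts G) + card (edges G)) \<and> reg s 0 = (if diam G = 4 then 1 else 0)"
      unfolding runs_def by (meson le_trans)
  qed
qed

end
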